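(* Let $d\ge 3$, let $V_0\in \mathrm{O}(d^{2}-1)$ be a real orthogonal matrix and $t\in\mathbb{R}$ such that $\mathcal{K}=tV_0\in\mathbb{K}^{(d)}$, and let $\varrho=\frac{1}{d^{2}}\bigl(\mathbb{1}_{d}\otimes\mathbb{1}_{d}+\sum_{j=1}^{d^{2}-1}\langle tV_0e_{j},\lambda\rangle\otimes\langle e_{j},\lambda\rangle\bigr)$ be the corresponding locally maximally mixed two-qudit state. Then $$D_2^M(\varrho)=\frac{4t^{2}}{d^{2}}.$$ Consequently, for these states the lower bound $D_2^M(\varrho)\ge\frac{4}{d^3(d-1)}\,\Xi(\mathcal{K})$ holds with equality, where $\Xi(\mathcal K)=\sum_{j=d}^{d^2-1}\eta_j^{\downarrow}$ and $\eta_1^{\downarrow}\ge\dots\ge\eta_{d^2-1}^{\downarrow}$ are the eigenvalues of $\mathcal{K}\mathcal{K}^T$.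
   Context: Generators: $\lambda_{1},\dots,\lambda_{d^{2}-1}$ are the standard (generalized Gell-Mann) Hermitian generators of $\mathrm{su}(d)$: for $k=2,\dots,d$ and $1\le j<k$, $\lambda_{(k-1)^{2}+2(j-1)}=E_{jk}+E_{kj}$, $\lambda_{(k-1)^{2}+2(j-1)+1}=-i(E_{jk}-E_{kj})$, and $\lambda_{k^{2}-1}=\sqrt{\tfrac{2}{k(k-1)}}\,\mathrm{diag}(1,\dots,1,-(k-1),0,\dots,0)$ (with $k-1$ ones), where $E_{jk}$ are matrix units. They satisfy $\operatorname{tr}\lambda_j=0$, $\operatorname{tr}(\lambda_j\lambda_k)=2\delta_{jk}$. For $n\in\mathbb{R}^{d^{2}-1}$, $\langle n,\lambda\rangle=\sum_j n_j\lambda_j$; $\{e_j\}$ is the canonical basis of $\mathbb{R}^{d^{2}-1}$. States: a state of two qudits is a positive semidefinite operator of trace one on $\mathbb{C}^{d}\otimes\mathbb{C}^{d}$. It is locally maximally mixed if both partial traces equal $\mathbb{1}_d/d$; such states are exactly those of the form $\varrho=\frac{1}{d^{2}}(\mathbb{1}_{d}\otimes\mathbb{1}_{d}+\sum_{j}\langle \mathcal{K}e_{j},\lambda\rangle\otimes\langle e_{j},\lambda\rangle)$ with $\mathcal{K}\in M_{d^2-1}(\mathbb{R})$ (the correlation matrix) such that $\varrho\ge 0$. $\mathbb{K}^{(d)}$ denotes the set of all such matrices $\mathcal{K}$. Discord: a local projective measurement on the first subsystem is $\mathbb{P}_{\mathcal{A}}=\mathbb{P}\otimes\mathrm{id}$,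 $\mathbb{P}(A)=\sum_{k=1}^{d}P_kAP_k$, where $P_1,\dots,P_d$ are mutually orthogonal one-dimensional orthogonal projectors on $\mathbb{C}^d$ with $\sum_k P_k=\mathbb{1}_d$. With $\|A\|_2=\sqrt{\operatorname{tr}A^*A}$, $$D_2^M(\varrho)=\frac{d}{d-1}\min_{\mathbb{P}_{\mathcal{A}}}\|\varrho-\mathbb{P}_{\mathcal{A}}(\varrho)\|_2^2,$$ the minimum being over all such measurements. *)

theory Defs
  imports
    "Jordan_Normal_Form.Schur_Decomposition"
    "Jordan_Normal_Form.DL_Rank"
    "HOL-Library.Discrete_Functions"
    "HOL-Computational_Algebra.Fundamental_Theorem_Algebra"
begin

section \<open>Matrices\<close>

definition mtrace :: "'a :: comm_monoid_add mat \<Rightarrow> 'a" where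
  "mtrace A = (\<Sum>i<dim_row A. A $$ (i, i))"

text \<open>The sum of a family of \<open>n \<times> n\<close> matrices, taken entrywise.\<close>

definition mat_sum :: "nat \<Rightarrow> 'i set \<Rightarrow> ('i \<Rightarrow> 'a :: comm_monoid_add mat) \<Rightarrow> 'a mat" where
  "mat_sum n I f = mat n n (\<lambda>rc. \<Sum>i\<in>I. f i $$ rc)"

text \<open>Kronecker product: the basis vector \<open>e\<^sub>a \<otimes> e\<^sub>p\<close> of the tensor product has the
  number \<open>a * n + p\<close>, where \<open>n\<close> is the dimension of the second factor.\<close>

definition kron :: "'a :: times mat \<Rightarrow> 'a mat \<Rightarrow> 'a mat" (infixl \<open>\<otimes>\<^sub>K\<close> 70) where
  "A \<otimes>\<^sub>K B = mat (dim_row A * dim_row B) (dim_col A * dim_col B)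
     (\<lambda>(r, c). A $$ (r div dim_row B, c div dim_col B) * B $$ (r mod dim_row B, c mod dim_col B))"

text \<open>The order on \<open>complex\<close> is the partial one: \<open>0 \<le> z\<close> says that \<open>z\<close> is real and
  nonnegative. So the quadratic form is real-valued and \<open>A\<close> is automatically Hermitian.\<close>

definition psd :: "nat \<Rightarrow> complex mat \<Rightarrow> bool" where
  "psd n A \<longleftrightarrow> A \<in> carrier_mat n n \<and> (\<forall>v \<in> carrier_vec n. 0 \<le> (A *\<^sub>v v) \<bullet>c v)"

definition hs_norm :: "complex mat \<Rightarrow> real" where
  "hs_norm A = sqrt (Re (mtrace (mat_adjoint A * A)))"

definition orthogonal_group :: "nat \<Rightarrow> real mat set" where
  "orthogonal_group n =
     {V \<in> carrier_mat n n. transpose_mat V * V = 1\<^sub>m n \<and> V * transpose_mat V = 1\<^sub>m n}"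

text \<open>Real eigenvalues, repeated according to their algebraic multiplicity, in decreasing order.
  For a symmetric matrix these are all \<open>n\<close> eigenvalues.\<close>

definition eigvals_desc :: "real mat \<Rightarrow> real list" where
  "eigvals_desc A = rev (sorted_list_of_multiset (proots (char_poly A)))"


section \<open>Generalized Gell-Mann generators\<close>

text \<open>Row and column numbers \<open>j\<close>, \<open>k\<close> start at 1, whereas library matrices are indexed
  from 0.\<close>

definition mat_unit :: "nat \<Rightarrow> nat \<Rightarrow> nat \<Rightarrow> complex mat" where
  "mat_unit d j k = mat d d (\<lambda>(a, b). if Suc a = j \<and> Suc b = k then 1 else 0)"

definition gm_diag :: "nat \<Rightarrow> nat \<Rightarrow> complex mat" where
  "gm_diag d k = complex_of_real (sqrt (2 / (real k * (real k - 1)))) \<cdot>\<^sub>m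
     mat d d (\<lambda>(a, b). if a \<noteq> b \<or> k \<le> a then 0
                      else if Suc a = k then - (of_nat k - 1) else 1)"

text \<open>\<open>gell_mann d l\<close> is meant for \<open>l \<in> {1..d\<^sup>2 - 1}\<close>. Such an \<open>l\<close> lies in exactly one block
  \<open>{(k - 1)\<^sup>2..k\<^sup>2 - 1}\<close> with \<open>2 \<le> k \<le> d\<close>; the position \<open>r\<close> inside the block determines the kind
  of generator. The lemmas below recover the usual numbering.\<close>

definition gell_mann :: "nat \<Rightarrow> nat \<Rightarrow> complex mat" where
  "gell_mann d l =
     (let k = Suc (floor_sqrt l); r = l - (k - 1)\<^sup>2; j = Suc (r div 2) in
      if l = k\<^sup>2 - 1 then gm_diag d k
      else if even r then mat_unit d j k + mat_unit d k j
      else (- \<i>) \<cdot>\<^sub>m (mat_unit d j k - mat_unit d k j))"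

lemma gell_mann_block:
  assumes "1 \<le> j" "j < k" "s \<le> 1"
  defines "l \<equiv> (k - 1)\<^sup>2 + 2 * (j - 1) + s"
  shows "floor_sqrt l = k - 1" "l - (k - 1)\<^sup>2 = 2 * (j - 1) + s" "l \<noteq> k\<^sup>2 - 1"
proof -
  obtain m where k: "k = Suc m" using assms(2) by (cases k) auto
  have lt: "l < m\<^sup>2 + 2 * m"
    using assms(1-3) by (simp add: l_def k)
  have sq: "(Suc m)\<^sup>2 = m\<^sup>2 + 2 * m + 1"
    by (simp add: power2_eq_square)
  show "l \<noteq> k\<^sup>2 - 1" unfolding k sq using lt by linarith
  have "m\<^sup>2 \<le> l" by (simp add: l_def k)
  moreover have "l < (Suc m)\<^sup>2" unfolding sq using lt by linarith
  ultimately show "floor_sqrt l = k - 1"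
    by (simp add: k floor_sqrt_unique)
  show "l - (k - 1)\<^sup>2 = 2 * (j - 1) + s" by (simp add: l_def)
qed

lemma gell_mann_sym:
  assumes "1 \<le> j" "j < k"
  shows "gell_mann d ((k - 1)\<^sup>2 + 2 * (j - 1)) = mat_unit d j k + mat_unit d k j"
  using gell_mann_block[OF assms, of 0] assms by (simp add: gell_mann_def Let_def)

lemma gell_mann_antisym:
  assumes "1 \<le> j" "j < k"
  shows "gell_mann d ((k - 1)\<^sup>2 + 2 * (j - 1) + 1) = (- \<i>) \<cdot>\<^sub>m (mat_unit d j k - mat_unit d k j)"
  using gell_mann_block[OF assms, of 1] assms by (simp add: gell_mann_def Let_def)

lemma gell_mann_diag:
  assumes "2 \<le> k"
  shows "gell_mann d (k\<^sup>2 - 1) = gm_diag d k"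
proof -
  obtain m where k: "k = Suc m" using assms by (cases k) auto
  have "floor_sqrt (k\<^sup>2 - 1) = m"
    by (rule floor_sqrt_unique) (auto simp: k power2_eq_square)
  then show ?thesis by (simp add: gell_mann_def Let_def k)
qed


section \<open>Locally maximally mixed states\<close>

text \<open>The pairing of a coordinate vector with the generators; the coordinate \<open>n\<^sub>j\<close> is the library's
  \<open>n $ (j - 1)\<close>, and \<open>e\<^sub>j\<close> is \<open>unit_vec (d\<^sup>2 - 1) (j - 1)\<close>.\<close>

definition gm_pair :: "nat \<Rightarrow> real vec \<Rightarrow> complex mat" where
  "gm_pair d n = mat_sum d {1..d\<^sup>2 - 1} (\<lambda>j. complex_of_real (n $ (j - 1)) \<cdot>\<^sub>m gell_mann d j)"

definition lmm_state :: "nat \<Rightarrow> real mat \<Rightarrow> complex mat" where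
  "lmm_state d K = (1 / of_nat (d\<^sup>2)) \<cdot>\<^sub>m
     (1\<^sub>m d \<otimes>\<^sub>K 1\<^sub>m d +
      mat_sum (d * d) {1..d\<^sup>2 - 1} (\<lambda>j.
        gm_pair d (K *\<^sub>v unit_vec (d\<^sup>2 - 1) (j - 1)) \<otimes>\<^sub>K gm_pair d (unit_vec (d\<^sup>2 - 1) (j - 1))))"

text \<open>Only positivity has to be required: since the generators are traceless, \<open>lmm_state d K\<close> has
  trace one and maximally mixed marginals for every \<open>K\<close>.\<close>

definition corr_matrices :: "nat \<Rightarrow> real mat set" where
  "corr_matrices d =
     {K \<in> carrier_mat (d\<^sup>2 - 1) (d\<^sup>2 - 1). psd (d * d) (lmm_state d K)}"

definition Xi :: "nat \<Rightarrow> real mat \<Rightarrow> real" where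
  "Xi d K = (\<Sum>j = d..d\<^sup>2 - 1. eigvals_desc (K * transpose_mat K) ! (j - 1))"


section \<open>Measurement-induced geometric discord\<close>

definition projective_measurement :: "nat \<Rightarrow> (nat \<Rightarrow> complex mat) \<Rightarrow> bool" where
  "projective_measurement d P \<longleftrightarrow>
     (\<forall>k\<in>{1..d}. P k \<in> carrier_mat d d \<and> mat_adjoint (P k) = P k \<and> P k * P k = P k \<and>
                 vec_space.rank d (P k) = 1) \<and>
     (\<forall>k\<in>{1..d}. \<forall>l\<in>{1..d}. k \<noteq> l \<longrightarrow> P k * P l = 0\<^sub>m d d) \<and>
     mat_sum d {1..d} P = 1\<^sub>m d"

definition measure_map :: "nat \<Rightarrow> (nat \<Rightarrow> complex mat) \<Rightarrow> complex mat \<Rightarrow> complex mat" where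
  "measure_map d P A = mat_sum d {1..d} (\<lambda>k. P k * A * P k)"

text \<open>The map \<open>\<Phi> \<otimes> id\<close> on operators on the tensor square, for linear \<open>\<Phi>\<close>: writing
  \<open>X = (\<Sum>p q. X\<^sub>p\<^sub>q \<otimes> E\<^sub>p\<^sub>q)\<close>, with blocks \<open>X\<^sub>p\<^sub>q\<close> acting on the first factor, it sends \<open>X\<close> to
  \<open>(\<Sum>p q. \<Phi> X\<^sub>p\<^sub>q \<otimes> E\<^sub>p\<^sub>q)\<close>.\<close>

definition first_block :: "nat \<Rightarrow> complex mat \<Rightarrow> nat \<Rightarrow> nat \<Rightarrow> complex mat" where
  "first_block d X p q = mat d d (\<lambda>(a, b). X $$ (a * d + p, b * d + q))"

definition map_first :: "nat \<Rightarrow> (complex mat \<Rightarrow> complex mat) \<Rightarrow> complex mat \<Rightarrow> complex mat" where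
  "map_first d \<Phi> X = mat (d * d) (d * d)
     (\<lambda>(r, c). \<Phi> (first_block d X (r mod d) (c mod d)) $$ (r div d, c div d))"

lemma first_block_kron:
  assumes "A \<in> carrier_mat d d" "B \<in> carrier_mat d d" "p < d" "q < d"
  shows "first_block d (A \<otimes>\<^sub>K B) p q = B $$ (p, q) \<cdot>\<^sub>m A"
proof -
  have "a * d + p < d * d" if "a < d" "p < d" for a p
  proof -
    have "a * d + p < Suc a * d" using that by simp
    also have "\<dots> \<le> d * d" using that by (intro mult_right_mono) auto
    finally show ?thesis .
  qed
  then show ?thesis
    using assms by (intro eq_matI) (auto simp: first_block_def kron_def)
qed

lemma map_first_kron:
  assumes A: "A \<in> carrier_mat d d" and B: "B \<in> carrier_mat d d"
    and \<Phi>: "\<Phi> A \<in> carrier_mat d d" "\<And>c. \<Phi> (c \<cdot>\<^sub>m A) = c \<cdot>\<^sub>m \<Phi> A"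
  shows "map_first d \<Phi> (A \<otimes>\<^sub>K B) = \<Phi> A \<otimes>\<^sub>K B"
proof (rule eq_matI)
  fix r c assume "r < dim_row (\<Phi> A \<otimes>\<^sub>K B)" "c < dim_col (\<Phi> A \<otimes>\<^sub>K B)"
  then have rc: "r < d * d" "c < d * d"
    using B \<Phi>(1) by (auto simp: kron_def)
  then have "0 < d" by (cases d) auto
  then have "r mod d < d" "c mod d < d" "r div d < d" "c div d < d"
    using rc by (auto simp: less_mult_imp_div_less)
  then show "map_first d \<Phi> (A \<otimes>\<^sub>K B) $$ (r, c) = (\<Phi> A \<otimes>\<^sub>K B) $$ (r, c)"
    using rc A B \<Phi>(1) first_block_kron[OF A B, of "r mod d" "c mod d"]
    by (auto simp: map_first_def \<Phi>(2)) (auto simp: kron_def)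
qed (use B \<Phi>(1) in \<open>auto simp: map_first_def kron_def\<close>)

text \<open>\<open>LEAST\<close> over the reals is the attained minimum, not an infimum.\<close>

definition discord :: "nat \<Rightarrow> complex mat \<Rightarrow> real" where
  "discord d \<rho> = real d / (real d - 1) *
     (LEAST x. x \<in> {(hs_norm (\<rho> - map_first d (measure_map d P) \<rho>))\<^sup>2 | P.
                    projective_measurement d P})"

end

theory Submission
  imports Defs "Jordan_Normal_Form.DL_Rank_Submatrix"
begin

text \<open>The generators satisfy the completeness relation
  \<open>(\<Sum>l. \<lambda>\<^sub>l[a,b] cnj (\<lambda>\<^sub>l[c,e])) = 2 \<delta>\<^sub>a\<^sub>c \<delta>\<^sub>b\<^sub>e - (2/d) \<delta>\<^sub>a\<^sub>b \<delta>\<^sub>c\<^sub>e\<close>, that is, they form an orthogonal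
  basis of the traceless matrices. Orthogonality in the second tensor factor and of \<open>V\<^sub>0\<close> therefore
  turns the squared distance \<open>\<parallel>\<rho> - P\<^sub>A \<rho>\<parallel>\<^sup>2\<close> into \<open>2 t\<^sup>2 / d\<^sup>4\<close> times
  \<open>(\<Sum>l. \<parallel>\<lambda>\<^sub>l - P \<lambda>\<^sub>l\<parallel>\<^sup>2)\<close>, which by completeness is twice the squared Hilbert-Schmidt norm of the
  superoperator \<open>id - P\<close>, since this kills the identity. As \<open>id - P\<close> is an
  orthogonal projection, its squared norm is its rank \<open>d\<^sup>2 - d\<close>, whatever the measurement, so
  the minimum is over a one-element set.\<close>

section \<open>Sums over the indices of a tensor square\<close>

text \<open>Splits the number of a basis vector of the tensor product into its two factors, in
  accordance with the numbering \<open>a * d + p\<close> of the Kronecker product.\<close>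

lemma sum_mult_square_index:
  fixes f :: "nat \<Rightarrow> nat \<Rightarrow> 'a :: comm_monoid_add"
  shows "(\<Sum>r<m * d. f (r div d) (r mod d)) = (\<Sum>a<m. \<Sum>p<d. f a p)"
proof -
  have "(\<Sum>r = a * d..<a * d + d. f (r div d) (r mod d)) = (\<Sum>p<d. f a p)" for a
  proof -
    have "(\<Sum>r = a * d..<a * d + d. f (r div d) (r mod d)) =
        (\<Sum>p = 0..<d. f ((p + a * d) div d) ((p + a * d) mod d))"
      using sum.shift_bounds_nat_ivl[of "\<lambda>r. f (r div d) (r mod d)" 0 "a * d" d]
      by (simp add: add.commute)
    also have "\<dots> = (\<Sum>p<d. f a p)"
      by (rule sum.cong) auto
    finally show ?thesis .
  qed
  then show ?thesis
    by (simp flip: sum.nat_group)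
qed

lemma mult_add_less_square:
  fixes a d p :: nat
  assumes "a < d" "p < d"
  shows "a * d + p < d * d"
proof -
  have "a * d + p < Suc a * d" using assms by simp
  also have "\<dots> \<le> d * d" using assms by (intro mult_right_mono) auto
  finally show ?thesis .
qed

section \<open>Completeness and orthogonality of the generators\<close>

text \<open>Mirrors the numbering of the generators. With \<open>m = n\<^sup>2\<close> the range
  runs up to \<open>(n + 1)\<^sup>2\<close>: first \<open>n\<close> pairs of a symmetric and an
  antisymmetric generator, then a single diagonal one.\<close>

lemma sum_triangular_block:
  fixes f :: "nat \<Rightarrow> 'a :: comm_monoid_add"
  shows "(\<Sum>l = m..<m + (2 * n + 1). f l) =
    (\<Sum>j<n. f (m + 2 * j) + f (m + 2 * j + 1)) + f (m + 2 * n)"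
proof -
  have "(\<Sum>l = m..<m + 2 * n. f l) = (\<Sum>j<n. f (m + 2 * j) + f (m + 2 * j + 1))"
    by (induction n) (auto simp: add.assoc)
  then show ?thesis by simp
qed

lemma sum_if_conj:
  fixes a n :: nat
  shows "(\<Sum>j<n. if a = j \<and> Q then x else 0) = (if a < n \<and> Q then x else (0::complex))"
  by (cases Q; cases "a < n") (auto simp: sum.delta')

text \<open>Indices count from 0, so this is the block of \<open>k = n + 1\<close>. In the pair
  number \<open>j\<close> the factor \<open>- \<i>\<close> is squared, so products of equally
  oriented matrix units cancel between the symmetric and the antisymmetric generator, while those of
  opposite orientation add up to 2. This leaves the positions \<open>(j, n)\<close> with
  \<open>(n, j)\<close> and vice versa.\<close>

lemma gell_mann_block_sum:
  fixes a b c e :: nat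
  assumes n: "1 \<le> n" and lt: "a < d" "b < d" "c < d" "e < d"
  shows "(\<Sum>l = n\<^sup>2..<(Suc n)\<^sup>2. gell_mann d l $$ (a, b) * gell_mann d l $$ (c, e)) =
    (if a < n \<and> e = a \<and> b = n \<and> c = n then 2 else 0) +
    (if b < n \<and> c = b \<and> a = n \<and> e = n then 2 else 0) +
    gm_diag d (Suc n) $$ (a, b) * gm_diag d (Suc n) $$ (c, e)"
proof -
  have sym: "gell_mann d (n\<^sup>2 + 2 * j) = mat_unit d (Suc j) (Suc n) + mat_unit d (Suc n) (Suc j)"
    if "j < n" for j
    using gell_mann_sym[of "Suc j" "Suc n" d] that by simp
  have asym: "gell_mann d (n\<^sup>2 + 2 * j + 1) =
      (- \<i>) \<cdot>\<^sub>m (mat_unit d (Suc j) (Suc n) - mat_unit d (Suc n) (Suc j))"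
    if "j < n" for j
    using gell_mann_antisym[of "Suc j" "Suc n" d] that by simp
  have diag: "gell_mann d (n\<^sup>2 + 2 * n) = gm_diag d (Suc n)"
  proof -
    have "(Suc n)\<^sup>2 - 1 = n\<^sup>2 + 2 * n" by (simp add: power2_eq_square)
    then show ?thesis using gell_mann_diag[of "Suc n" d] n by simp
  qed
  have idx: "(Suc n)\<^sup>2 = n\<^sup>2 + (2 * n + 1)" by (simp add: power2_eq_square)
  have pair: "gell_mann d (n\<^sup>2 + 2 * j) $$ (a, b) * gell_mann d (n\<^sup>2 + 2 * j) $$ (c, e) +
      gell_mann d (n\<^sup>2 + 2 * j + 1) $$ (a, b) * gell_mann d (n\<^sup>2 + 2 * j + 1) $$ (c, e) =
      (if a = j \<and> (e = a \<and> b = n \<and> c = n) then 2 else 0) +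
      (if b = j \<and> (c = b \<and> a = n \<and> e = n) then 2 else 0)" if "j < n" for j
    unfolding sym[OF that] asym[OF that] using lt that
    by (simp add: mat_unit_def algebra_simps)
  show ?thesis
    unfolding idx sum_triangular_block diag
    by (subst sum.cong[OF refl pair]) (simp_all only: lessThan_iff sum.distrib sum_if_conj conj_assoc)
qed

text \<open>In a product of two entries the normalization occurs squared, so the square root
  disappears and the remaining algebra is rational.\<close>

lemma gm_diag_mult_index:
  assumes "1 \<le> n" "a < d" "b < d" "c < d" "e < d"
  shows "gm_diag d (Suc n) $$ (a, b) * gm_diag d (Suc n) $$ (c, e) =
     (2 / ((of_nat n + 1) * of_nat n)) *
     ((if a \<noteq> b \<or> n < a then 0 else if a = n then - of_nat n else 1) *
      (if c \<noteq> e \<or> n < c then 0 else if c = n then - of_nat n else 1))"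
proof -
  define s where "s = complex_of_real (sqrt (2 / (real (Suc n) * (real (Suc n) - 1))))"
  have ss: "2 / ((of_nat n + 1) * of_nat n) = s * s"
  proof -
    have "s * s = complex_of_real (2 / (real (Suc n) * (real (Suc n) - 1)))"
      unfolding s_def by (simp flip: of_real_mult)
    then show ?thesis by (simp add: add.commute)
  qed
  have ent: "gm_diag d (Suc n) $$ (a, b) =
      s * (if a \<noteq> b \<or> n < a then 0 else if a = n then - of_nat n else 1)"
    if "a < d" "b < d" for a b
    using that by (simp add: gm_diag_def s_def Suc_le_eq)
  show ?thesis
    unfolding ss ent[OF assms(2,3)] ent[OF assms(4,5)] by (simp only: mult_ac)
qed

text \<open>The generators numbered below \<open>n\<^sup>2\<close> live in the upper left corner of
  size \<open>n\<close> and satisfy there the completeness relation of dimension \<open>n\<close>.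
  In this form the relation can be proved by induction on \<open>n\<close>, one block at a time.
  Without the conjugate the first term pairs transposed positions.\<close>

lemma gell_mann_partial_completeness:
  assumes "1 \<le> n" "a < d" "b < d" "c < d" "e < d"
  shows "(\<Sum>l = 1..<n\<^sup>2. gell_mann d l $$ (a, b) * gell_mann d l $$ (c, e)) =
    (if a < n \<and> b < n \<and> c < n \<and> e < n
     then (if a = e \<and> b = c then 2 else 0) - (if a = b \<and> c = e then 2 / of_nat n else 0) else 0)"
  using assms(1)
proof (induction n rule: nat_induct_at_least)
  case base
  \<comment> \<open>No generators are summed, and at the only index below 1 the right-hand side is
    \<open>2 - 2 / 1 = 0\<close>.\<close>
  show ?case
    by (cases "a = 0"; cases "b = 0"; cases "c = 0"; cases "e = 0") auto
next
  case (Suc n)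
  have le: "1 \<le> n\<^sup>2" "n\<^sup>2 \<le> (Suc n)\<^sup>2" using Suc.hyps by auto
  define x where "x = complex_of_nat n"
  have Suc_x: "complex_of_nat (Suc n) = x + 1"
    by (simp add: x_def)
  have x: "x \<noteq> 0" "x + 1 \<noteq> 0"
    using Suc.hyps of_nat_neq_0[of n, where 'a = complex] by (simp_all add: x_def add.commute)
  have "(\<Sum>l = 1..<(Suc n)\<^sup>2. gell_mann d l $$ (a, b) * gell_mann d l $$ (c, e)) =
    (\<Sum>l = 1..<n\<^sup>2. gell_mann d l $$ (a, b) * gell_mann d l $$ (c, e)) +
    (\<Sum>l = n\<^sup>2..<(Suc n)\<^sup>2. gell_mann d l $$ (a, b) * gell_mann d l $$ (c, e))"
    by (rule sum.atLeastLessThan_concat[OF le, symmetric])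
  also have "\<dots> = (if a < Suc n \<and> b < Suc n \<and> c < Suc n \<and> e < Suc n
     then (if a = e \<and> b = c then 2 else 0) - (if a = b \<and> c = e then 2 / of_nat (Suc n) else 0)
     else 0)"
    (is "?lhs = ?rhs")
  proof (cases "a = b \<and> c = e")
    case True
    then have eq: "b = a" "e = c" by auto
    \<comment> \<open>Here \<open>y\<close> is the squared normalization of the new diagonal
      generator and \<open>r\<close> the new coefficient of the trace term. The three identities
      below settle, in this order, the cases of \<open>a\<close> and \<open>c\<close> both below
      \<open>n\<close>, exactly one equal to \<open>n\<close>, and both equal to
      \<open>n\<close>.\<close>
    define y where "y = 2 / ((x + 1) * x)"
    define r where "r = 2 / (x + 1)"
    have y: "2 / x = y + r" "y * x = r" "y * (x * x) = 2 - r"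
      unfolding y_def r_def using x by (simp_all add: divide_simps) (simp_all add: algebra_simps)
    show ?thesis
      unfolding Suc.IH gell_mann_block_sum[OF Suc.hyps(1) assms(2-5)]
        gm_diag_mult_index[OF Suc.hyps(1) assms(2-5)]
      unfolding eq Suc_x x_def[symmetric] y_def[symmetric] r_def[symmetric] y(1)
      using y(2,3)
      by (cases a n rule: linorder_cases; cases c n rule: linorder_cases; cases "a = c"; simp)
  next
    case False
    then have prod: "(if a \<noteq> b \<or> n < a then 0 else if a = n then - of_nat n else 1) *
        (if c \<noteq> e \<or> n < c then 0 else if c = n then - of_nat n else 1) = (0 :: complex)"
      by (cases "a = b") simp_all
    show ?thesis
    proof (cases "e = a \<and> c = b")
      case True
      \<comment> \<open>For transposed off-diagonal positions the value 2 arises exactly once, in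
        the block where the larger of \<open>a\<close> and \<open>b\<close> equals \<open>n\<close>;
        afterwards the induction hypothesis carries it along.\<close>
      then have eq: "e = a" "c = b" by auto
      with False have ne: "a \<noteq> b" "b \<noteq> a" by auto
      show ?thesis
        unfolding Suc.IH gell_mann_block_sum[OF Suc.hyps(1) assms(2-5)]
          gm_diag_mult_index[OF Suc.hyps(1) assms(2-5)] prod unfolding eq
        using ne by (cases a n rule: linorder_cases; cases b n rule: linorder_cases; simp)
    next
      case ne: False
      then have conds: "(a < n \<and> e = a \<and> b = n \<and> c = n) = False"
        "(b < n \<and> c = b \<and> a = n \<and> e = n) = False" "(a = e \<and> b = c) = False"
        "(a = b \<and> c = e) = False"
        using False by blast+
      show ?thesis
        unfolding Suc.IH gell_mann_block_sum[OF Suc.hyps(1) assms(2-5)]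
          gm_diag_mult_index[OF Suc.hyps(1) assms(2-5)] prod conds
        by simp
    qed
  qed
  finally show ?case .
qed

lemma gell_mann_carrier: "gell_mann d l \<in> carrier_mat d d"
  by (auto simp: gell_mann_def gm_diag_def mat_unit_def Let_def)

lemma gell_mann_hermitian:
  assumes "a < d" "b < d"
  shows "cnj (gell_mann d l $$ (a, b)) = gell_mann d l $$ (b, a)"
proof -
  consider k where "gell_mann d l = gm_diag d k"
    | j k where "gell_mann d l = mat_unit d j k + mat_unit d k j"
    | j k where "gell_mann d l = (- \<i>) \<cdot>\<^sub>m (mat_unit d j k - mat_unit d k j)"
    unfolding gell_mann_def Let_def by metis
  then show ?thesis
  proof cases
    case 1
    then show ?thesis using assms by (cases "a = b") (simp_all add: gm_diag_def)
  next
    case (2 j k)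
    then show ?thesis using assms
      by (cases "Suc a = j"; cases "Suc b = k"; cases "Suc a = k"; cases "Suc b = j";
          simp add: mat_unit_def)
  next
    case (3 j k)
    then show ?thesis using assms
      by (cases "Suc a = j"; cases "Suc b = k"; cases "Suc a = k"; cases "Suc b = j";
          simp add: mat_unit_def)
  qed
qed

text \<open>This is the partial relation at \<open>n = d\<close>, in which Hermiticity of the
  generators trades the conjugate for an exchange of \<open>c\<close> and \<open>e\<close>.\<close>

lemma gell_mann_completeness:
  assumes "a < d" "b < d" "c < d" "e < d"
  shows "(\<Sum>l = 1..d\<^sup>2 - 1. gell_mann d l $$ (a, b) * cnj (gell_mann d l $$ (c, e))) =
    (if a = c \<and> b = e then 2 else 0) - (if a = b \<and> c = e then 2 / of_nat d else 0)"
proof -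
  have "{1..d\<^sup>2 - 1} = {1..<d\<^sup>2}"
    using assms by (cases "d\<^sup>2") auto
  then have "(\<Sum>l = 1..d\<^sup>2 - 1. gell_mann d l $$ (a, b) * cnj (gell_mann d l $$ (c, e))) =
      (\<Sum>l = 1..<d\<^sup>2. gell_mann d l $$ (a, b) * gell_mann d l $$ (e, c))"
    using assms by (simp add: gell_mann_hermitian)
  also have "\<dots> = (if a < d \<and> b < d \<and> e < d \<and> c < d
      then (if a = c \<and> b = e then 2 else 0) - (if a = b \<and> e = c then 2 / of_nat d else 0) else 0)"
    using assms by (intro gell_mann_partial_completeness) auto
  finally show ?thesis
    by (simp only: assms simp_thms if_True eq_commute[of e c])
qed

text \<open>Together with a multiple of the identity, the generators form a square matrix of size
  \<open>d\<^sup>2\<close>. Completeness says that its rows are orthogonal, and hence so are its columns.\<close>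

lemma gell_mann_orthogonal:
  assumes "j \<in> {1..d\<^sup>2 - 1}" "k \<in> {1..d\<^sup>2 - 1}"
  shows "(\<Sum>a<d. \<Sum>b<d. gell_mann d j $$ (a, b) * cnj (gell_mann d k $$ (a, b))) =
    (if j = k then 2 else 0)"
proof -
  have d: "d > 0" using assms by (cases d) auto
  \<comment> \<open>Index 0 carries the identity scaled by \<open>sqrt (2 / d)\<close>. Its squared
    norm is 2 like that of the generators, and its contribution \<open>2 / d\<close> cancels the
    trace term of the completeness relation. The matrix \<open>N\<close> is half the adjoint of
    \<open>M\<close>, hence a right inverse by completeness.\<close>
  define g where "g l a b = (if l = 0 then (if a = b then of_real (sqrt (2 / d)) else 0)
    else gell_mann d l $$ (a, b))" for l a b
  define M where "M = mat (d * d) (d * d) (\<lambda>(r, l). g l (r div d) (r mod d))"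
  define N where "N = mat (d * d) (d * d) (\<lambda>(l, r). cnj (g l (r div d) (r mod d)) / 2)"
  have carr: "M \<in> carrier_mat (d * d) (d * d)" "N \<in> carrier_mat (d * d) (d * d)"
    by (simp_all add: M_def N_def)
  have split0: "{..<d * d} = insert 0 {1..d\<^sup>2 - 1}"
    using d by (auto simp: power2_eq_square Suc_le_eq)
  have s2: "complex_of_real (sqrt (2 / d)) * complex_of_real (sqrt (2 / d)) = 2 / of_nat d"
    by (simp flip: of_real_mult)
  have rows: "(\<Sum>l<d * d. g l a b * cnj (g l c e)) = (if a = c \<and> b = e then 2 else 0)"
    if "a < d" "b < d" "c < d" "e < d" for a b c e
  proof -
    have "(\<Sum>l = 1..d\<^sup>2 - 1. g l a b * cnj (g l c e)) =
        (\<Sum>l = 1..d\<^sup>2 - 1. gell_mann d l $$ (a, b) * cnj (gell_mann d l $$ (c, e)))"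
      by (rule sum.cong) (auto simp: g_def)
    then show ?thesis
      unfolding split0 using gell_mann_completeness[OF that] s2
      by (cases "a = b"; cases "c = e"; cases "a = c \<and> b = e"; simp add: g_def)
  qed
  have "M * N = 1\<^sub>m (d * d)"
  proof (rule eq_matI)
    fix r s assume "r < dim_row (1\<^sub>m (d * d))" "s < dim_col (1\<^sub>m (d * d))"
    then have rs: "r < d * d" "s < d * d" by auto
    then have lt: "r div d < d" "s div d < d" "r mod d < d" "s mod d < d"
      using d by (auto simp: less_mult_imp_div_less)
    have eq: "r div d = s div d \<and> r mod d = s mod d \<longleftrightarrow> r = s"
      by (metis div_mult_mod_eq)
    have "(M * N) $$ (r, s) =
        (\<Sum>l<d * d. g l (r div d) (r mod d) * cnj (g l (s div d) (s mod d))) / 2"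
      using rs by (simp add: M_def N_def scalar_prod_def sum_divide_distrib lessThan_atLeast0)
    also have "\<dots> = (if r = s then 1 else 0)"
      unfolding rows[OF lt(1,3,2,4)] eq by simp
    finally show "(M * N) $$ (r, s) = 1\<^sub>m (d * d) $$ (r, s)"
      using rs by simp
  qed (simp_all add: M_def N_def)
  then have NM: "N * M = 1\<^sub>m (d * d)"
    by (rule mat_mult_left_right_inverse[OF carr])
  have jk: "j < d * d" "k < d * d" "j \<noteq> 0" "k \<noteq> 0"
  proof -
    have "j \<in> {..<d * d}" "k \<in> {..<d * d}"
      using assms unfolding split0 by blast+
    then show "j < d * d" "k < d * d"
      by (simp_all only: lessThan_iff)
    show "j \<noteq> 0" "k \<noteq> 0"
      using assms by simp_all
  qed
  have "(\<Sum>a<d. \<Sum>b<d. gell_mann d j $$ (a, b) * cnj (gell_mann d k $$ (a, b))) =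
      (\<Sum>r<d * d. gell_mann d j $$ (r div d, r mod d) * cnj (gell_mann d k $$ (r div d, r mod d)))"
    by (rule sum_mult_square_index[symmetric])
  also have "\<dots> = 2 * (N * M) $$ (k, j)"
  proof -
    have "2 * (N * M) $$ (k, j) = (\<Sum>r<d * d. 2 * (N $$ (k, r) * M $$ (r, j)))"
      using jk carr by (simp add: scalar_prod_def sum_distrib_left lessThan_atLeast0)
    also have "\<dots> = (\<Sum>r<d * d. gell_mann d j $$ (r div d, r mod d) *
        cnj (gell_mann d k $$ (r div d, r mod d)))"
      using jk by (intro sum.cong refl) (simp add: M_def N_def g_def)
    finally show ?thesis by (rule sym)
  qed
  also have "\<dots> = (if j = k then 2 else 0)"
    using jk unfolding NM by simp
  finally show ?thesis .
qed

section \<open>Squared norms and Gram matrices\<close>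

lemma sum_mult_cnj_expand:
  fixes z :: "'i \<Rightarrow> complex" and u :: "'i \<Rightarrow> 'x \<Rightarrow> complex"
  shows "(\<Sum>x\<in>X. (\<Sum>j\<in>J. z j * u j x) * cnj (\<Sum>j\<in>J. z j * u j x)) =
    (\<Sum>j\<in>J. \<Sum>k\<in>J. z j * cnj (z k) * (\<Sum>x\<in>X. u j x * cnj (u k x)))"
proof -
  have "(\<Sum>x\<in>X. (\<Sum>j\<in>J. z j * u j x) * cnj (\<Sum>j\<in>J. z j * u j x)) =
      (\<Sum>x\<in>X. \<Sum>j\<in>J. \<Sum>k\<in>J. z j * cnj (z k) * (u j x * cnj (u k x)))"
    by (simp add: sum_product mult_ac)
  also have "\<dots> = (\<Sum>j\<in>J. \<Sum>k\<in>J. \<Sum>x\<in>X. z j * cnj (z k) * (u j x * cnj (u k x)))"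
    by (subst sum.swap, rule sum.cong[OF refl], rule sum.swap)
  finally show ?thesis
    by (simp add: sum_distrib_left)
qed

lemma sum_mult_cnj_orthogonal:
  fixes z :: "'i \<Rightarrow> complex" and u :: "'i \<Rightarrow> 'x \<Rightarrow> complex"
  assumes "finite J"
    and "\<And>j k. j \<in> J \<Longrightarrow> k \<in> J \<Longrightarrow>
      (\<Sum>x\<in>X. u j x * cnj (u k x)) = (if j = k then c else 0)"
  shows "(\<Sum>x\<in>X. (\<Sum>j\<in>J. z j * u j x) * cnj (\<Sum>j\<in>J. z j * u j x)) =
    c * (\<Sum>j\<in>J. z j * cnj (z j))"
proof -
  have "(\<Sum>j\<in>J. \<Sum>k\<in>J. z j * cnj (z k) * (\<Sum>x\<in>X. u j x * cnj (u k x))) =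
      (\<Sum>j\<in>J. \<Sum>k\<in>J. if k = j then z j * cnj (z j) * c else 0)"
    by (intro sum.cong refl) (simp add: assms(2))
  also have "\<dots> = c * (\<Sum>j\<in>J. z j * cnj (z j))"
    using assms(1) by (simp add: sum_distrib_left mult_ac)
  finally show ?thesis
    by (simp only: sum_mult_cnj_expand)
qed

text \<open>The Gram matrix of the product functions \<open>u k x * v k y\<close> is the entrywise
  product of the two Gram matrices.\<close>

lemma sum_mult_cnj_product:
  fixes u :: "'i \<Rightarrow> 'x \<Rightarrow> complex" and v :: "'i \<Rightarrow> 'y \<Rightarrow> complex"
  shows "(\<Sum>x\<in>X. \<Sum>y\<in>Y. (\<Sum>k\<in>J. u k x * v k y) * cnj (\<Sum>k\<in>J. u k x * v k y)) =
    (\<Sum>k\<in>J. \<Sum>l\<in>J. (\<Sum>x\<in>X. u k x * cnj (u l x)) * (\<Sum>y\<in>Y. v k y * cnj (v l y)))"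
proof -
  have "(\<Sum>x\<in>X. \<Sum>y\<in>Y. (\<Sum>k\<in>J. u k x * v k y) * cnj (\<Sum>k\<in>J. u k x * v k y)) =
      (\<Sum>w\<in>X \<times> Y. (\<Sum>k\<in>J. 1 * (u k (fst w) * v k (snd w))) *
        cnj (\<Sum>k\<in>J. 1 * (u k (fst w) * v k (snd w))))"
    by (simp add: sum.cartesian_product case_prod_unfold)
  also have "\<dots> = (\<Sum>k\<in>J. \<Sum>l\<in>J. \<Sum>w\<in>X \<times> Y.
      (u k (fst w) * v k (snd w)) * cnj (u l (fst w) * v l (snd w)))"
    by (subst sum_mult_cnj_expand) simp
  also have "\<dots> = (\<Sum>k\<in>J. \<Sum>l\<in>J.
      (\<Sum>x\<in>X. u k x * cnj (u l x)) * (\<Sum>y\<in>Y. v k y * cnj (v l y)))"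
    by (simp add: sum_product sum.cartesian_product case_prod_unfold mult_ac)
  finally show ?thesis .
qed

lemma mult_mat_index:
  assumes "A \<in> carrier_mat n m" "B \<in> carrier_mat m l" "a < n" "b < l"
  shows "(A * B) $$ (a, b) = (\<Sum>c<m. A $$ (a, c) * B $$ (c, b))"
  using assms by (simp add: scalar_prod_def lessThan_atLeast0)

lemma mat_adjoint_index:
  assumes "A \<in> carrier_mat n m" "i < m" "j < n"
  shows "mat_adjoint A $$ (i, j) = conjugate (A $$ (j, i))"
  using assms by (simp add: mat_adjoint_def mat_of_rows_index)

text \<open>Stated over the complex numbers, where the Gram expansions take place. Taking
  \<open>Re\<close> in the norm loses nothing, because the trace is a sum of squared moduli.\<close>

lemma hs_norm_square:
  assumes "A \<in> carrier_mat n m"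
  shows "complex_of_real ((hs_norm A)\<^sup>2) = (\<Sum>r<n. \<Sum>s<m. A $$ (r, s) * cnj (A $$ (r, s)))"
proof -
  have dims: "dim_row (mat_adjoint A) = m" "dim_col (mat_adjoint A) = n"
    using assms by (auto simp: mat_adjoint_def)
  have "mtrace (mat_adjoint A * A) = (\<Sum>s<m. \<Sum>r<n. mat_adjoint A $$ (s, r) * A $$ (r, s))"
    using assms dims by (simp add: mtrace_def scalar_prod_def lessThan_atLeast0)
  also have "\<dots> = (\<Sum>s<m. \<Sum>r<n. A $$ (r, s) * cnj (A $$ (r, s)))"
    by (intro sum.cong refl) (simp add: mat_adjoint_index[OF assms] conjugate_complex_def)
  also have "\<dots> = (\<Sum>r<n. \<Sum>s<m. A $$ (r, s) * cnj (A $$ (r, s)))"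
    by (rule sum.swap)
  finally have tr: "mtrace (mat_adjoint A * A) =
    (\<Sum>r<n. \<Sum>s<m. A $$ (r, s) * cnj (A $$ (r, s)))" .
  also have "\<dots> = complex_of_real (\<Sum>r<n. \<Sum>s<m. (cmod (A $$ (r, s)))\<^sup>2)"
    by (simp only: of_real_sum complex_norm_square)
  finally have *: "mtrace (mat_adjoint A * A) =
    complex_of_real (\<Sum>r<n. \<Sum>s<m. (cmod (A $$ (r, s)))\<^sup>2)" .
  have "(hs_norm A)\<^sup>2 = (\<Sum>r<n. \<Sum>s<m. (cmod (A $$ (r, s)))\<^sup>2)"
    unfolding hs_norm_def * by (simp add: sum_nonneg)
  then show ?thesis
    using tr * by simp
qed

section \<open>Measurement projectors and the norm of the superoperator id - P\<close>

text \<open>A nonzero column spans a line in the range of the projector; the projector onto that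
  line has trace one, and the remainder has nonnegative trace. Such a lower bound replaces a direct
  comparison of rank and trace.\<close>

lemma projector_trace_ge_one:
  fixes p :: "nat \<Rightarrow> nat \<Rightarrow> complex"
  assumes herm: "\<And>a c. a < d \<Longrightarrow> c < d \<Longrightarrow> cnj (p a c) = p c a"
    and idem: "\<And>a b. a < d \<Longrightarrow> b < d \<Longrightarrow> (\<Sum>c<d. p a c * p c b) = p a b"
    and nz: "a0 < d" "b < d" "p a0 b \<noteq> 0"
  shows "1 \<le> Re (\<Sum>a<d. p a a)"
proof -
  \<comment> \<open>By Hermiticity and idempotence \<open>p b b\<close> is the squared norm of
    column \<open>b\<close>, hence nonzero and usable as a divisor.\<close>
  have "p b b = (\<Sum>c<d. p c b * cnj (p c b))"
    using herm nz by (simp add: mult.commute flip: idem[of b b])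
  also have "\<dots> = of_real (\<Sum>c<d. (cmod (p c b))\<^sup>2)"
    by (simp only: of_real_sum complex_norm_square)
  finally have pbb: "p b b = of_real (\<Sum>c<d. (cmod (p c b))\<^sup>2)" .
  have "0 < (cmod (p a0 b))\<^sup>2"
    using nz by simp
  also have "\<dots> \<le> (\<Sum>c<d. (cmod (p c b))\<^sup>2)"
    by (rule member_le_sum) (use nz in auto)
  finally have b0: "p b b \<noteq> 0"
    unfolding pbb of_real_eq_0_iff by (rule less_imp_neq[symmetric])
  \<comment> \<open>Subtracting the projector onto column \<open>b\<close> leaves a projector, whose trace is a sum of squares.\<close>
  define R where "R a c = p a c - p a b * p b c / p b b" for a c
  have cnjR: "cnj (R a c) = R c a" if "a < d" "c < d" for a c
    using that nz by (simp add: R_def herm mult.commute)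
  \<comment> \<open>The diagonal of \<open>R * R\<close> turns out to be that of \<open>R\<close>,
    so the trace of \<open>R\<close> becomes the squared norm of \<open>R\<close>.\<close>
  have row: "(\<Sum>c<d. R a c * R c a) = p a a - p a b * p b a / p b b" if a: "a < d" for a
  proof -
    have "R a c * R c a = p a c * p c a - p b a / p b b * (p a c * p c b)
        - p a b / p b b * (p b c * p c a)
        + p a b * p b a / (p b b * p b b) * (p b c * p c b)" for c
      by (simp add: R_def algebra_simps)
    then have "(\<Sum>c<d. R a c * R c a) = (\<Sum>c<d. p a c * p c a)
        - p b a / p b b * (\<Sum>c<d. p a c * p c b) - p a b / p b b * (\<Sum>c<d. p b c * p c a)
        + p a b * p b a / (p b b * p b b) * (\<Sum>c<d. p b c * p c b)"
      by (simp only: sum.distrib sum_subtractf sum_distrib_left)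
    also have "\<dots> = p a a - p b a / p b b * p a b - p a b / p b b * p b a
        + p a b * p b a / (p b b * p b b) * p b b"
      by (simp only: idem a nz)
    finally show ?thesis
      using b0 by (simp add: mult.commute)
  qed
  have "(\<Sum>a<d. \<Sum>c<d. R a c * R c a) = (\<Sum>a<d. p a a) - (\<Sum>a<d. p b a * p a b) / p b b"
    by (simp add: row sum_subtractf sum_divide_distrib mult.commute)
  also have "\<dots> = (\<Sum>a<d. p a a) - 1"
    using idem nz b0 by simp
  finally have tr: "(\<Sum>a<d. p a a) - 1 = (\<Sum>a<d. \<Sum>c<d. R a c * R c a)" ..
  also have "\<dots> = (\<Sum>a<d. \<Sum>c<d. R a c * cnj (R a c))"
    by (intro sum.cong refl) (simp add: cnjR)
  also have "\<dots> = of_real (\<Sum>a<d. \<Sum>c<d. (cmod (R a c))\<^sup>2)"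
    by (simp only: of_real_sum complex_norm_square)
  finally have "Re ((\<Sum>a<d. p a a) - 1) = (\<Sum>a<d. \<Sum>c<d. (cmod (R a c))\<^sup>2)"
    by (simp only: Re_complex_of_real)
  then have "Re (\<Sum>a<d. p a a) - 1 = (\<Sum>a<d. \<Sum>c<d. (cmod (R a c))\<^sup>2)"
    by (simp only: minus_complex.sel one_complex.sel)
  moreover have "0 \<le> (\<Sum>a<d. \<Sum>c<d. (cmod (R a c))\<^sup>2)"
    by (intro sum_nonneg) simp
  ultimately show ?thesis by linarith
qed

lemma projective_measurement_index:
  assumes "projective_measurement d P" "a < d" "b < d"
  shows projective_measurement_hermitian:
      "k \<in> {1..d} \<Longrightarrow> cnj (P k $$ (a, b)) = P k $$ (b, a)"
    and projective_measurement_mult: "k \<in> {1..d} \<Longrightarrow> l \<in> {1..d} \<Longrightarrow>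
      (\<Sum>c<d. P k $$ (a, c) * P l $$ (c, b)) = (if k = l then P k $$ (a, b) else 0)"
    and projective_measurement_sum:
      "(\<Sum>k = 1..d. P k $$ (a, b)) = (if a = b then 1 else 0)"
proof -
  have carr: "P k \<in> carrier_mat d d" and adj: "mat_adjoint (P k) = P k"
    and idem: "P k * P k = P k" if "k \<in> {1..d}" for k
    using assms(1) that by (auto simp: projective_measurement_def)
  have orth: "P k * P l = 0\<^sub>m d d" if "k \<in> {1..d}" "l \<in> {1..d}" "k \<noteq> l" for k l
    using assms(1) that unfolding projective_measurement_def by blast
  have total: "mat_sum d {1..d} P = 1\<^sub>m d"
    using assms(1) by (simp add: projective_measurement_def)
  show "cnj (P k $$ (a, b)) = P k $$ (b, a)" if "k \<in> {1..d}"
    using mat_adjoint_index[OF carr[OF that] assms(3,2)] adj[OF that]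
    by (simp add: conjugate_complex_def)
  show "(\<Sum>c<d. P k $$ (a, c) * P l $$ (c, b)) = (if k = l then P k $$ (a, b) else 0)"
    if kl: "k \<in> {1..d}" "l \<in> {1..d}"
  proof -
    have "(\<Sum>c<d. P k $$ (a, c) * P l $$ (c, b)) = (P k * P l) $$ (a, b)"
      using carr[OF kl(1)] carr[OF kl(2)] assms(2,3)
      by (simp add: scalar_prod_def lessThan_atLeast0)
    also have "\<dots> = (if k = l then P k $$ (a, b) else 0)"
    proof (cases "k = l")
      case True
      then show ?thesis using idem[OF kl(1)] by simp
    next
      case False
      then show ?thesis using orth[OF kl False] assms(2,3) by simp
    qed
    finally show ?thesis .
  qed
  show "(\<Sum>k = 1..d. P k $$ (a, b)) = (if a = b then 1 else 0)"
    using arg_cong[OF total, of "\<lambda>A. A $$ (a, b)"] assms(2,3)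
    by (cases "a = b") (simp_all add: mat_sum_def)
qed

text \<open>Having rank one, each projector is nonzero and so has trace at least one. The
  \<open>d\<close> traces add up to the trace \<open>d\<close> of the identity, which forces
  equality throughout.\<close>

lemma projective_measurement_trace:
  assumes P: "projective_measurement d P" and k: "k \<in> {1..d}"
  shows "(\<Sum>a<d. P k $$ (a, a)) = 1"
proof -
  have ge: "1 \<le> Re (\<Sum>a<d. P l $$ (a, a))" if l: "l \<in> {1..d}" for l
  proof -
    have carr: "P l \<in> carrier_mat d d" and rank: "vec_space.rank d (P l) = 1"
      using P l by (auto simp: projective_measurement_def)
    have "P l \<noteq> 0\<^sub>m d d"
      using rank vec_space.rank_0I[of d d, where 'a = complex] by auto
    then obtain a b where ab: "a < d" "b < d" "P l $$ (a, b) \<noteq> 0"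
      using carr by (metis carrier_matD eq_matI index_zero_mat)
    show ?thesis
    proof (rule projector_trace_ge_one[where p = "\<lambda>a b. P l $$ (a, b)", OF _ _ ab])
      fix a c assume "a < d" "c < d"
      then show "cnj (P l $$ (a, c)) = P l $$ (c, a)"
        "(\<Sum>b<d. P l $$ (a, b) * P l $$ (b, c)) = P l $$ (a, c)"
        using projective_measurement_hermitian[OF P _ _ l]
          projective_measurement_mult[OF P _ _ l l] by simp_all
    qed
  qed
  have "(\<Sum>l = 1..d. \<Sum>a<d. P l $$ (a, a)) = (\<Sum>a<d. \<Sum>l = 1..d. P l $$ (a, a))"
    by (rule sum.swap)
  also have "\<dots> = (\<Sum>a<d. 1)"
    by (intro sum.cong refl) (simp only: projective_measurement_sum[OF P] lessThan_iff if_True simp_thms)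
  finally have "Re (\<Sum>l = 1..d. \<Sum>a<d. P l $$ (a, a)) = real d"
    by simp
  then have "(\<Sum>l = 1..d. Re (\<Sum>a<d. P l $$ (a, a)) - 1) = 0"
    by (simp only: Re_sum sum_subtractf) simp
  then have "\<forall>l\<in>{1..d}. Re (\<Sum>a<d. P l $$ (a, a)) - 1 = 0"
    by (subst (asm) sum_nonneg_eq_0_iff) (use ge in auto)
  then have "Re (\<Sum>a<d. P k $$ (a, a)) = 1"
    using k by simp
  moreover have "cnj (\<Sum>a<d. P k $$ (a, a)) = (\<Sum>a<d. P k $$ (a, a))"
    using projective_measurement_hermitian[OF P _ _ k] by simp
  then have "Im (\<Sum>a<d. P k $$ (a, a)) = 0"
    by (metis complex_is_Real_iff Reals_cnj_iff)
  ultimately show ?thesis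
    by (simp add: complex_eq_iff)
qed

text \<open>The matrix of the map \<open>X \<mapsto> X - (\<Sum>k. P\<^sub>k X P\<^sub>k)\<close> with respect to the matrix units.\<close>

definition defect_kernel ::
    "nat \<Rightarrow> (nat \<Rightarrow> complex mat) \<Rightarrow> nat \<Rightarrow> nat \<Rightarrow> nat \<times> nat \<Rightarrow> complex" where
  "defect_kernel d P a b = (\<lambda>(c, e).
     (if a = c \<and> e = b then 1 else 0) - (\<Sum>k = 1..d. P k $$ (a, c) * P k $$ (e, b)))"

text \<open>The identity is unchanged by the measurement, since the projectors are idempotent and
  sum to it. This is the vanishing-trace condition under which the frame identity for the generators
  applies.\<close>

lemma defect_kernel_unital:
  assumes P: "projective_measurement d P" and ab: "a < d" "b < d"
  shows "(\<Sum>c<d. defect_kernel d P a b (c, c)) = 0"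
proof -
  have "(\<Sum>c<d. \<Sum>k = 1..d. P k $$ (a, c) * P k $$ (c, b)) =
      (\<Sum>k = 1..d. \<Sum>c<d. P k $$ (a, c) * P k $$ (c, b))"
    by (rule sum.swap)
  also have "\<dots> = (\<Sum>k = 1..d. P k $$ (a, b))"
    by (intro sum.cong refl) (simp add: projective_measurement_mult[OF P ab])
  also have "\<dots> = (if a = b then 1 else 0)"
    by (rule projective_measurement_sum[OF P ab])
  finally have "(\<Sum>c<d. \<Sum>k = 1..d. P k $$ (a, c) * P k $$ (c, b)) = (if a = b then 1 else 0)" .
  moreover have "(\<Sum>c<d. if a = c \<and> c = b then 1 else 0) = (if a = b then 1 else (0 :: complex))"
  proof (cases "a = b")
    case True
    have "(\<Sum>c<d. if a = c \<and> c = b then 1 else 0) = (\<Sum>c<d. if c = a then 1 else (0 :: complex))"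
      using True by (intro sum.cong refl if_cong) auto
    then show ?thesis using True ab by simp
  next
    case False
    then show ?thesis by (auto intro!: sum.neutral)
  qed
  ultimately show ?thesis
    by (simp only: defect_kernel_def prod.case sum_subtractf) simp
qed

text \<open>Regrouped by the index pairs \<open>(a, c)\<close> and \<open>(e, b)\<close>, the kernel
  is a signed sum of product functions. Hence only the Gram matrix \<open>g\<close> of the identity
  and the projectors enters, entrywise squared, and traces and orthogonality of the projectors
  determine it for every measurement.\<close>

lemma defect_kernel_norm:
  assumes P: "projective_measurement d P"
  shows "(\<Sum>a<d. \<Sum>b<d. \<Sum>x\<in>{..<d} \<times> {..<d}.
      defect_kernel d P a b x * cnj (defect_kernel d P a b x)) = of_nat d * of_nat d - of_nat d"
proof -
  \<comment> \<open>The index 0 absorbs the identity map, so that the kernel is a single sum of products.\<close>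
  define Q where "Q k = (if k = 0 then 1\<^sub>m d else P k)" for k :: nat
  define \<sigma> where "\<sigma> k = (if k = 0 then 1 else - 1 :: complex)" for k :: nat
  define g where "g k l = (\<Sum>x\<in>{..<d} \<times> {..<d}. Q k $$ x * cnj (Q l $$ x))" for k l
  have ker: "defect_kernel d P a b (c, e) = (\<Sum>k\<in>insert 0 {1..d}. Q k $$ (a, c) * (\<sigma> k * Q k $$ (e, b)))"
    if "a < d" "b < d" "c < d" "e < d" for a b c e
  proof -
    have "(\<Sum>k = 1..d. Q k $$ (a, c) * (\<sigma> k * Q k $$ (e, b))) =
        - (\<Sum>k = 1..d. P k $$ (a, c) * P k $$ (e, b))"
      unfolding sum_negf[symmetric] by (intro sum.cong refl) (simp add: Q_def \<sigma>_def)
    moreover have "Q 0 $$ (a, c) * (\<sigma> 0 * Q 0 $$ (e, b)) = (if a = c \<and> e = b then 1 else 0)"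
      using that by (cases "a = c"; cases "e = b"; simp add: Q_def \<sigma>_def)
    ultimately show ?thesis
      by (simp add: defect_kernel_def)
  qed
  have "(\<Sum>a<d. \<Sum>b<d. \<Sum>x\<in>{..<d} \<times> {..<d}.
      defect_kernel d P a b x * cnj (defect_kernel d P a b x)) =
    (\<Sum>a<d. \<Sum>b<d. \<Sum>c<d. \<Sum>e<d.
      defect_kernel d P a b (c, e) * cnj (defect_kernel d P a b (c, e)))"
    by (simp add: sum.cartesian_product)
  also have "\<dots> = (\<Sum>a<d. \<Sum>c<d. \<Sum>b<d. \<Sum>e<d.
      defect_kernel d P a b (c, e) * cnj (defect_kernel d P a b (c, e)))"
    by (intro sum.cong refl sum.swap)
  also have "\<dots> = (\<Sum>a<d. \<Sum>c<d. \<Sum>e<d. \<Sum>b<d.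
      defect_kernel d P a b (c, e) * cnj (defect_kernel d P a b (c, e)))"
    by (intro sum.cong refl sum.swap)
  also have "\<dots> = (\<Sum>a<d. \<Sum>c<d. \<Sum>e<d. \<Sum>b<d.
      (\<Sum>k\<in>insert 0 {1..d}. Q k $$ (a, c) * (\<sigma> k * Q k $$ (e, b))) *
      cnj (\<Sum>k\<in>insert 0 {1..d}. Q k $$ (a, c) * (\<sigma> k * Q k $$ (e, b))))"
    by (intro sum.cong refl) (simp only: ker lessThan_iff)
  also have "\<dots> = (\<Sum>x\<in>{..<d} \<times> {..<d}. \<Sum>y\<in>{..<d} \<times> {..<d}.
      (\<Sum>k\<in>insert 0 {1..d}. Q k $$ x * (\<sigma> k * Q k $$ y)) *
      cnj (\<Sum>k\<in>insert 0 {1..d}. Q k $$ x * (\<sigma> k * Q k $$ y)))"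
    by (simp only: sum.cartesian_product')
  also have "\<dots> = (\<Sum>k\<in>insert 0 {1..d}. \<Sum>l\<in>insert 0 {1..d}.
      g k l * (\<Sum>y\<in>{..<d} \<times> {..<d}. (\<sigma> k * Q k $$ y) * cnj (\<sigma> l * Q l $$ y)))"
    unfolding g_def by (rule sum_mult_cnj_product)
  also have "\<dots> = (\<Sum>k\<in>insert 0 {1..d}. \<Sum>l\<in>insert 0 {1..d}. \<sigma> k * \<sigma> l * (g k l * g k l))"
  proof (intro sum.cong refl)
    fix k l
    have "cnj (\<sigma> l) = \<sigma> l" by (simp add: \<sigma>_def)
    then have "(\<Sum>y\<in>{..<d} \<times> {..<d}. (\<sigma> k * Q k $$ y) * cnj (\<sigma> l * Q l $$ y)) = \<sigma> k * \<sigma> l * g k l"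
      by (simp add: g_def sum_distrib_left mult_ac)
    then show "g k l * (\<Sum>y\<in>{..<d} \<times> {..<d}. (\<sigma> k * Q k $$ y) * cnj (\<sigma> l * Q l $$ y)) =
        \<sigma> k * \<sigma> l * (g k l * g k l)"
      by simp
  qed
  also have "\<dots> = of_nat d * of_nat d - of_nat d"
  proof -
    have g: "g k l = (\<Sum>a<d. \<Sum>c<d. Q k $$ (a, c) * cnj (Q l $$ (a, c)))" for k l
      by (simp add: g_def sum.cartesian_product case_prod_unfold)
    have g00: "g 0 0 = of_nat d"
    proof -
      have "(\<Sum>c<d. Q 0 $$ (a, c) * cnj (Q 0 $$ (a, c))) = (\<Sum>c<d. if c = a then 1 else 0)"
        if "a < d" for a
        using that by (intro sum.cong refl) (simp add: Q_def)
      then show ?thesis by (simp add: g)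
    qed
    have gk0: "g k 0 = 1" if k: "k \<in> {1..d}" for k
    proof -
      have "(\<Sum>c<d. Q k $$ (a, c) * cnj (Q 0 $$ (a, c))) = (\<Sum>c<d. if c = a then P k $$ (a, a) else 0)"
        if "a < d" for a
        using that k by (intro sum.cong refl) (simp add: Q_def)
      then show ?thesis
        using projective_measurement_trace[OF P k] by (simp add: g)
    qed
    have g0k: "g 0 k = 1" if "k \<in> {1..d}" for k
    proof -
      have "g 0 k = cnj (g k 0)" by (simp add: g_def mult.commute)
      then show ?thesis using gk0[OF that] by simp
    qed
    have gkl: "g k l = (if k = l then 1 else 0)" if k: "k \<in> {1..d}" and l: "l \<in> {1..d}" for k l
    proof -
      have "g k l = (\<Sum>a<d. \<Sum>c<d. P k $$ (a, c) * P l $$ (c, a))"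
        unfolding g using k l
        by (intro sum.cong refl) (simp add: Q_def projective_measurement_hermitian[OF P])
      also have "\<dots> = (\<Sum>a<d. if k = l then P k $$ (a, a) else 0)"
        by (intro sum.cong refl) (simp only: projective_measurement_mult[OF P _ _ k l] lessThan_iff)
      also have "\<dots> = (if k = l then 1 else 0)"
        using projective_measurement_trace[OF P k] by (cases "k = l") simp_all
      finally show ?thesis .
    qed
    \<comment> \<open>Row \<open>k\<close> cancels: its entry at 0 is \<open>- 1\<close>, and its
      only other nonzero entry, at \<open>l = k\<close>, is 1. Row 0 remains, with
      \<open>d\<^sup>2\<close> at 0 and \<open>- 1\<close> at each of the \<open>d\<close>
      projectors.\<close>
    have inner: "(\<Sum>l\<in>insert 0 {1..d}. \<sigma> k * \<sigma> l * (g k l * g k l)) = 0" if k: "k \<in> {1..d}" for k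
    proof -
      have "(\<Sum>l = 1..d. \<sigma> k * \<sigma> l * (g k l * g k l)) = (\<Sum>l = 1..d. if l = k then 1 else 0)"
        using k by (intro sum.cong refl) (simp add: gkl \<sigma>_def)
      then show ?thesis
        using k gk0[OF k] by (simp add: \<sigma>_def)
    qed
    have "(\<Sum>l = 1..d. \<sigma> 0 * \<sigma> l * (g 0 l * g 0 l)) = (\<Sum>l = 1..d. - 1)"
      by (intro sum.cong refl) (simp add: g0k \<sigma>_def)
    then have first: "(\<Sum>l\<in>insert 0 {1..d}. \<sigma> 0 * \<sigma> l * (g 0 l * g 0 l)) = of_nat d * of_nat d - of_nat d"
      by (simp add: g00 \<sigma>_def)
    have "(\<Sum>k\<in>insert 0 {1..d}. \<Sum>l\<in>insert 0 {1..d}. \<sigma> k * \<sigma> l * (g k l * g k l)) =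
        (\<Sum>l\<in>insert 0 {1..d}. \<sigma> 0 * \<sigma> l * (g 0 l * g 0 l)) +
        (\<Sum>k = 1..d. \<Sum>l\<in>insert 0 {1..d}. \<sigma> k * \<sigma> l * (g k l * g k l))"
      by (rule sum.insert) simp_all
    also have "\<dots> = of_nat d * of_nat d - of_nat d"
      unfolding first by (subst sum.neutral) (use inner in auto)
    finally show ?thesis .
  qed
  finally show ?thesis .
qed

section \<open>Distance between the state and its measured image\<close>

text \<open>A Parseval identity. By completeness the quadratic form on the left has as matrix twice
  the identity minus \<open>2 / d\<close> times the rank-one matrix
  \<open>\<delta> x * \<delta> y\<close>, and the latter annihilates a \<open>z\<close> of vanishing
  trace.\<close>

lemma gell_mann_frame:
  fixes z :: "nat \<times> nat \<Rightarrow> complex"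
  assumes "(\<Sum>c<d. z (c, c)) = 0"
  shows "(\<Sum>l = 1..d\<^sup>2 - 1. (\<Sum>x\<in>{..<d} \<times> {..<d}. z x * gell_mann d l $$ x) *
      cnj (\<Sum>x\<in>{..<d} \<times> {..<d}. z x * gell_mann d l $$ x)) =
    2 * (\<Sum>x\<in>{..<d} \<times> {..<d}. z x * cnj (z x))"
proof -
  let ?D = "{..<d} \<times> {..<d}"
  define \<delta> where "\<delta> x = (if fst x = snd x then 1 else 0 :: complex)" for x :: "nat \<times> nat"
  have gram: "(\<Sum>l = 1..d\<^sup>2 - 1. gell_mann d l $$ x * cnj (gell_mann d l $$ y)) =
      (if y = x then 2 else 0) - 2 / of_nat d * (\<delta> x * \<delta> y)" if "x \<in> ?D" "y \<in> ?D" for x y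
  proof -
    obtain a b c e where xy: "x = (a, b)" "y = (c, e)" by (cases x; cases y)
    have eq: "(y = x) = (a = c \<and> b = e)" by (auto simp: xy)
    have "a < d" "b < d" "c < d" "e < d"
      using that by (auto simp: xy)
    then show ?thesis
      unfolding eq \<delta>_def unfolding xy
      by (subst gell_mann_completeness; cases "a = b"; cases "c = e") simp_all
  qed
  have "(\<Sum>x\<in>?D. z x * \<delta> x) = (\<Sum>a<d. \<Sum>b<d. z (a, b) * \<delta> (a, b))"
    by (simp add: sum.cartesian_product)
  also have "\<dots> = (\<Sum>a<d. \<Sum>b<d. if b = a then z (a, a) else 0)"
    by (intro sum.cong refl) (simp add: \<delta>_def)
  finally have diag: "(\<Sum>x\<in>?D. z x * \<delta> x) = 0"
    using assms by simp
  have "(\<Sum>l = 1..d\<^sup>2 - 1. (\<Sum>x\<in>?D. z x * gell_mann d l $$ x) *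
      cnj (\<Sum>x\<in>?D. z x * gell_mann d l $$ x)) =
    (\<Sum>x\<in>?D. \<Sum>y\<in>?D. z x * cnj (z y) *
      (\<Sum>l = 1..d\<^sup>2 - 1. gell_mann d l $$ x * cnj (gell_mann d l $$ y)))"
    by (rule sum_mult_cnj_expand)
  also have "\<dots> = (\<Sum>x\<in>?D. \<Sum>y\<in>?D. (if y = x then 2 * (z x * cnj (z x)) else 0) -
      2 / of_nat d * (z x * \<delta> x) * (cnj (z y) * \<delta> y))"
  proof (intro sum.cong refl)
    fix x y assume "x \<in> ?D" "y \<in> ?D"
    then show "z x * cnj (z y) * (\<Sum>l = 1..d\<^sup>2 - 1. gell_mann d l $$ x * cnj (gell_mann d l $$ y)) =
        (if y = x then 2 * (z x * cnj (z x)) else 0) -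
        2 / of_nat d * (z x * \<delta> x) * (cnj (z y) * \<delta> y)"
      unfolding gram[OF \<open>x \<in> ?D\<close> \<open>y \<in> ?D\<close>] by (cases "y = x") (simp_all add: algebra_simps)
  qed
  also have "\<dots> = 2 * (\<Sum>x\<in>?D. z x * cnj (z x)) -
      2 / of_nat d * (\<Sum>x\<in>?D. z x * \<delta> x) * (\<Sum>y\<in>?D. cnj (z y) * \<delta> y)"
    by (simp only: sum_subtractf sum_distrib_left[symmetric] sum_distrib_right[symmetric])
      (simp add: sum_distrib_left)
  finally show ?thesis
    unfolding diag by simp
qed

lemma kron_index:
  assumes "A \<in> carrier_mat d d" "B \<in> carrier_mat d d" "a < d" "b < d" "p < d" "q < d"
  shows "(A \<otimes>\<^sub>K B) $$ (a * d + p, b * d + q) = A $$ (a, b) * B $$ (p, q)"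
  using assms mult_add_less_square[of a d p] mult_add_less_square[of b d q]
  by (simp add: kron_def)

lemma gm_pair_carrier: "gm_pair d n \<in> carrier_mat d d"
  by (simp add: gm_pair_def mat_sum_def)

lemma gm_pair_index:
  assumes "a < d" "b < d"
  shows "gm_pair d n $$ (a, b) =
    (\<Sum>j = 1..d\<^sup>2 - 1. complex_of_real (n $ (j - 1)) * gell_mann d j $$ (a, b))"
  using assms gell_mann_carrier[THEN carrier_matD(1)] gell_mann_carrier[THEN carrier_matD(2)]
  by (simp add: gm_pair_def mat_sum_def)

lemma gm_pair_unit_vec:
  assumes j: "j \<in> {1..d\<^sup>2 - 1}"
  shows "gm_pair d (unit_vec (d\<^sup>2 - 1) (j - 1)) = gell_mann d j"
proof (rule eq_matI)
  fix a b assume "a < dim_row (gell_mann d j)" "b < dim_col (gell_mann d j)"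
  then have ab: "a < d" "b < d"
    using gell_mann_carrier[of d j] by auto
  have "(\<Sum>i = 1..d\<^sup>2 - 1. complex_of_real (unit_vec (d\<^sup>2 - 1) (j - 1) $ (i - 1)) *
      gell_mann d i $$ (a, b)) =
    (\<Sum>i = 1..d\<^sup>2 - 1. if i = j then gell_mann d i $$ (a, b) else 0)"
  proof (intro sum.cong refl)
    fix i assume "i \<in> {1..d\<^sup>2 - 1}"
    then show "complex_of_real (unit_vec (d\<^sup>2 - 1) (j - 1) $ (i - 1)) * gell_mann d i $$ (a, b) =
        (if i = j then gell_mann d i $$ (a, b) else 0)"
      using j by (cases "i = j") (auto simp: unit_vec_def)
  qed
  also have "\<dots> = gell_mann d j $$ (a, b)"
    using j by simp
  finally show "gm_pair d (unit_vec (d\<^sup>2 - 1) (j - 1)) $$ (a, b) = gell_mann d j $$ (a, b)"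
    by (simp only: gm_pair_index[OF ab])
qed (use gell_mann_carrier[of d j] gm_pair_carrier in auto)

lemma lmm_state_carrier: "lmm_state d K \<in> carrier_mat (d * d) (d * d)"
  by (simp add: lmm_state_def mat_sum_def kron_def)

lemma lmm_state_index:
  assumes K: "K \<in> carrier_mat (d\<^sup>2 - 1) (d\<^sup>2 - 1)"
    and lt: "a < d" "b < d" "p < d" "q < d"
  shows "lmm_state d K $$ (a * d + p, b * d + q) = 1 / of_nat (d\<^sup>2) *
    ((if a = b \<and> p = q then 1 else 0) +
     (\<Sum>j = 1..d\<^sup>2 - 1. (\<Sum>i = 1..d\<^sup>2 - 1. complex_of_real (K $$ (i - 1, j - 1)) *
        gell_mann d i $$ (a, b)) * gell_mann d j $$ (p, q)))"
proof -
  let ?r = "a * d + p" and ?s = "b * d + q"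
  let ?B = "\<lambda>j. gm_pair d (K *\<^sub>v unit_vec (d\<^sup>2 - 1) (j - 1)) \<otimes>\<^sub>K
    gm_pair d (unit_vec (d\<^sup>2 - 1) (j - 1))"
  have rs: "?r < d * d" "?s < d * d"
    using lt by (simp_all add: mult_add_less_square)
  have id: "(1\<^sub>m d \<otimes>\<^sub>K 1\<^sub>m d) $$ (?r, ?s) = (if a = b \<and> p = q then 1 else 0 :: complex)"
    using lt by (cases "a = b"; cases "p = q"; simp add: kron_index)
  have summand: "?B j $$ (?r, ?s) = (\<Sum>i = 1..d\<^sup>2 - 1. complex_of_real (K $$ (i - 1, j - 1)) *
      gell_mann d i $$ (a, b)) * gell_mann d j $$ (p, q)" if j: "j \<in> {1..d\<^sup>2 - 1}" for j
  proof -
    have "complex_of_real ((K *\<^sub>v unit_vec (d\<^sup>2 - 1) (j - 1)) $ (i - 1)) =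
        complex_of_real (K $$ (i - 1, j - 1))" if "i \<in> {1..d\<^sup>2 - 1}" for i
    proof -
      have "i - 1 < d\<^sup>2 - 1" "j - 1 < d\<^sup>2 - 1" using that j by auto
      then show ?thesis using K by simp
    qed
    then have "gm_pair d (K *\<^sub>v unit_vec (d\<^sup>2 - 1) (j - 1)) $$ (a, b) =
        (\<Sum>i = 1..d\<^sup>2 - 1. complex_of_real (K $$ (i - 1, j - 1)) * gell_mann d i $$ (a, b))"
      unfolding gm_pair_index[OF lt(1,2)] by (intro sum.cong refl) simp
    then show ?thesis
      using lt by (simp only: gm_pair_unit_vec[OF j] kron_index[OF gm_pair_carrier gell_mann_carrier])
  qed
  have dims: "1\<^sub>m d \<otimes>\<^sub>K 1\<^sub>m d \<in> carrier_mat (d * d) (d * d)"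
    by (simp add: kron_def)
  have "lmm_state d K $$ (?r, ?s) =
      1 / of_nat (d\<^sup>2) * ((1\<^sub>m d \<otimes>\<^sub>K 1\<^sub>m d) $$ (?r, ?s) + (\<Sum>j = 1..d\<^sup>2 - 1. ?B j $$ (?r, ?s)))"
    using rs dims by (simp add: lmm_state_def mat_sum_def)
  also have "(\<Sum>j = 1..d\<^sup>2 - 1. ?B j $$ (?r, ?s)) =
      (\<Sum>j = 1..d\<^sup>2 - 1. (\<Sum>i = 1..d\<^sup>2 - 1. complex_of_real (K $$ (i - 1, j - 1)) *
        gell_mann d i $$ (a, b)) * gell_mann d j $$ (p, q))"
    by (intro sum.cong refl summand)
  finally show ?thesis
    unfolding id .
qed

text \<open>For fixed \<open>p\<close> and \<open>q\<close> the measurement acts only on the block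
  with entries \<open>X $$ (c * d + p, e * d + q)\<close>, so its defect is the kernel applied to
  that block.\<close>

lemma measurement_defect_index:
  assumes P: "projective_measurement d P" and X: "X \<in> carrier_mat (d * d) (d * d)"
    and lt: "a < d" "b < d" "p < d" "q < d"
  shows "(X - map_first d (measure_map d P) X) $$ (a * d + p, b * d + q) =
    (\<Sum>(c, e)\<in>{..<d} \<times> {..<d}. defect_kernel d P a b (c, e) * X $$ (c * d + p, e * d + q))"
proof -
  define F where "F c e = X $$ (c * d + p, e * d + q)" for c e
  have rs: "a * d + p < d * d" "b * d + q < d * d"
    using lt by (simp_all add: mult_add_less_square)
  have carr: "P k \<in> carrier_mat d d" if "k \<in> {1..d}" for k
    using P that by (auto simp: projective_measurement_def)
  have block: "first_block d X p q \<in> carrier_mat d d"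
    by (simp add: first_block_def)
  have summand: "(P k * first_block d X p q * P k) $$ (a, b) =
      (\<Sum>e<d. \<Sum>c<d. P k $$ (a, c) * P k $$ (e, b) * F c e)" if k: "k \<in> {1..d}" for k
  proof -
    have "(P k * first_block d X p q) $$ (a, e) = (\<Sum>c<d. P k $$ (a, c) * F c e)" if "e < d" for e
      unfolding mult_mat_index[OF carr[OF k] block lt(1) that] using lt that
      by (intro sum.cong refl) (simp add: first_block_def F_def)
    then show ?thesis
      unfolding mult_mat_index[OF mult_carrier_mat[OF carr[OF k] block] carr[OF k] lt(1,2)]
      by (simp add: sum_distrib_left sum_distrib_right mult_ac)
  qed
  have "map_first d (measure_map d P) X $$ (a * d + p, b * d + q) =
      measure_map d P (first_block d X p q) $$ (a, b)"
    using rs lt by (simp add: map_first_def)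
  also have "\<dots> = (\<Sum>k = 1..d. (P k * first_block d X p q * P k) $$ (a, b))"
    using lt by (simp add: measure_map_def mat_sum_def)
  also have "\<dots> = (\<Sum>k = 1..d. \<Sum>e<d. \<Sum>c<d. P k $$ (a, c) * P k $$ (e, b) * F c e)"
    by (intro sum.cong refl summand)
  also have "\<dots> = (\<Sum>e<d. \<Sum>c<d. \<Sum>k = 1..d. P k $$ (a, c) * P k $$ (e, b) * F c e)"
    by (subst sum.swap, rule sum.cong[OF refl], rule sum.swap)
  also have "\<dots> = (\<Sum>c<d. \<Sum>e<d. \<Sum>k = 1..d. P k $$ (a, c) * P k $$ (e, b) * F c e)"
    by (rule sum.swap)
  finally have mapped: "map_first d (measure_map d P) X $$ (a * d + p, b * d + q) =
    (\<Sum>c<d. \<Sum>e<d. \<Sum>k = 1..d. P k $$ (a, c) * P k $$ (e, b) * F c e)" .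
  have inner: "(\<Sum>e<d. if a = c \<and> e = b then F c e else 0) = (if c = a then F a b else 0)" for c
    using lt by (cases "c = a") simp_all
  \<comment> \<open>The unmeasured entry is spread out as a sum against a Kronecker delta, so that
    it merges with the measured one into the kernel.\<close>
  have direct: "F a b = (\<Sum>c<d. \<Sum>e<d. if a = c \<and> e = b then F c e else 0)"
    unfolding inner using lt by simp
  have "(X - map_first d (measure_map d P) X) $$ (a * d + p, b * d + q) =
      F a b - (\<Sum>c<d. \<Sum>e<d. \<Sum>k = 1..d. P k $$ (a, c) * P k $$ (e, b) * F c e)"
    using rs X mapped by (simp add: map_first_def F_def)
  also have "\<dots> = (\<Sum>c<d. \<Sum>e<d. (if a = c \<and> e = b then F c e else 0) -
      (\<Sum>k = 1..d. P k $$ (a, c) * P k $$ (e, b) * F c e))"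
    by (subst direct) (simp only: sum_subtractf)
  also have "\<dots> = (\<Sum>c<d. \<Sum>e<d. defect_kernel d P a b (c, e) * F c e)"
  proof (intro sum.cong refl)
    fix c e
    show "(if a = c \<and> e = b then F c e else 0) -
        (\<Sum>k = 1..d. P k $$ (a, c) * P k $$ (e, b) * F c e) = defect_kernel d P a b (c, e) * F c e"
      by (cases "a = c \<and> e = b") (simp_all only: defect_kernel_def prod.case left_diff_distrib
        sum_distrib_right simp_thms if_True if_False mult_1 mult_zero_left)
  qed
  finally show ?thesis
    by (simp only: sum.cartesian_product F_def)
qed

text \<open>Three norm identities are chained: orthogonality of the generators on the second factor
  (constant 2), orthonormality of the rows of \<open>V\<close> (constant 1), and the frame identity
  on the first factor (constant 2). What remains is the kernel norm \<open>d\<^sup>2 - d\<close>,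
  multiplied by the prefactor \<open>t\<^sup>2 / d\<^sup>4\<close>.\<close>

lemma measurement_defect_norm:
  fixes t :: real
  assumes P: "projective_measurement d P" and d: "d > 0"
    and V: "V \<in> orthogonal_group (d\<^sup>2 - 1)"
  defines "\<rho> \<equiv> lmm_state d (t \<cdot>\<^sub>m V)"
  shows "(hs_norm (\<rho> - map_first d (measure_map d P) \<rho>))\<^sup>2 = 4 * t\<^sup>2 * (real d - 1) / real d ^ 3"
proof -
  let ?D = "{..<d} \<times> {..<d}" and ?I = "{1..d\<^sup>2 - 1}"
  define X where "X = \<rho> - map_first d (measure_map d P) \<rho>"
  define z where "z a b = defect_kernel d P a b" for a b
  \<comment> \<open>The number \<open>y a b i\<close> is the \<open>(a, b)\<close> entry of the
    defect of generator \<open>i\<close>, and \<open>w a b j\<close> that of the combination of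
    generators given by column \<open>j\<close> of \<open>V\<close>. Up to the factor
    \<open>n * t\<close>, the latter are the coordinates of \<open>X\<close> along generator
    \<open>j\<close> on the second factor.\<close>
  define y where "y a b i = (\<Sum>x\<in>?D. z a b x * gell_mann d i $$ x)" for a b i
  define v where "v i j = complex_of_real (V $$ (i - 1, j - 1))" for i j :: nat
  define w where "w a b j = (\<Sum>i\<in>?I. y a b i * v i j)" for a b j
  define n where "n = (1 / of_nat (d\<^sup>2) :: complex)"
  have Vc: "V \<in> carrier_mat (d\<^sup>2 - 1) (d\<^sup>2 - 1)" and VV: "V * transpose_mat V = 1\<^sub>m (d\<^sup>2 - 1)"
    using V by (auto simp: orthogonal_group_def)
  have entry: "X $$ (a * d + p, b * d + q) = (\<Sum>j\<in>?I. (n * of_real t * w a b j) * gell_mann d j $$ (p, q))"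
    if lt: "a < d" "b < d" "p < d" "q < d" for a b p q
  proof -
    have ent: "z a b x * \<rho> $$ (fst x * d + p, snd x * d + q) =
        n * (z a b x * (if fst x = snd x \<and> p = q then 1 else 0)) +
        (\<Sum>j\<in>?I. \<Sum>i\<in>?I. n * of_real t * (z a b x * gell_mann d i $$ x * v i j) *
          gell_mann d j $$ (p, q))"
      if "x \<in> ?D" for x
    proof -
      obtain c e where x: "x = (c, e)" "c < d" "e < d" using \<open>x \<in> ?D\<close> by (cases x) auto
      have "(\<Sum>i\<in>?I. complex_of_real ((t \<cdot>\<^sub>m V) $$ (i - 1, j - 1)) * gell_mann d i $$ (c, e)) =
          (\<Sum>i\<in>?I. of_real t * (v i j * gell_mann d i $$ (c, e)))" if j: "j \<in> ?I" for j
      proof (intro sum.cong refl)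
        fix i assume "i \<in> ?I"
        then have "i - 1 < d\<^sup>2 - 1" "j - 1 < d\<^sup>2 - 1" using j by auto
        then show "complex_of_real ((t \<cdot>\<^sub>m V) $$ (i - 1, j - 1)) * gell_mann d i $$ (c, e) =
            of_real t * (v i j * gell_mann d i $$ (c, e))"
          using Vc by (simp add: v_def)
      qed
      then have "\<rho> $$ (c * d + p, e * d + q) = n * ((if c = e \<and> p = q then 1 else 0) +
          (\<Sum>j\<in>?I. (\<Sum>i\<in>?I. of_real t * (v i j * gell_mann d i $$ (c, e))) * gell_mann d j $$ (p, q)))"
        unfolding \<rho>_def n_def using Vc lt x by (subst lmm_state_index) auto
      then show ?thesis
        unfolding x fst_conv snd_conv
        by (simp only: distrib_left sum_distrib_left sum_distrib_right mult_ac)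
    qed
    \<comment> \<open>The identity part of the state drops out, because the defect map kills the
      identity on the first factor.\<close>
    have tr: "(\<Sum>x\<in>?D. z a b x * (if fst x = snd x \<and> p = q then 1 else 0)) = 0"
    proof (cases "p = q")
      case True
      have "(\<Sum>x\<in>?D. z a b x * (if fst x = snd x \<and> p = q then 1 else 0)) =
          (\<Sum>c<d. \<Sum>e<d. if e = c then z a b (c, c) else 0)"
        unfolding sum.cartesian_product' using True by (intro sum.cong refl) simp
      also have "\<dots> = (\<Sum>c<d. z a b (c, c))"
        by simp
      also have "\<dots> = 0"
        unfolding z_def by (rule defect_kernel_unital[OF P lt(1,2)])
      finally show ?thesis .
    qed simp
    have "X $$ (a * d + p, b * d + q) = (\<Sum>x\<in>?D. z a b x * \<rho> $$ (fst x * d + p, snd x * d + q))"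
      unfolding X_def z_def using lmm_state_carrier lt
      by (subst measurement_defect_index[OF P]) (simp_all add: \<rho>_def case_prod_unfold)
    also have "\<dots> = n * (\<Sum>x\<in>?D. z a b x * (if fst x = snd x \<and> p = q then 1 else 0)) +
        (\<Sum>x\<in>?D. \<Sum>j\<in>?I. \<Sum>i\<in>?I. n * of_real t * (z a b x * gell_mann d i $$ x * v i j) *
          gell_mann d j $$ (p, q))"
      unfolding sum_distrib_left sum.distrib[symmetric] by (rule sum.cong[OF refl ent])
    also have "\<dots> = (\<Sum>x\<in>?D. \<Sum>j\<in>?I. \<Sum>i\<in>?I. n * of_real t * (z a b x * gell_mann d i $$ x * v i j) *
          gell_mann d j $$ (p, q))"
      unfolding tr by simp
    also have "\<dots> = (\<Sum>j\<in>?I. \<Sum>i\<in>?I. \<Sum>x\<in>?D. n * of_real t * (z a b x * gell_mann d i $$ x * v i j) *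
          gell_mann d j $$ (p, q))"
      by (subst sum.swap, rule sum.cong[OF refl], rule sum.swap)
    also have "\<dots> = (\<Sum>j\<in>?I. (n * of_real t * w a b j) * gell_mann d j $$ (p, q))"
      by (simp only: w_def y_def sum_distrib_left sum_distrib_right mult_ac)
    finally show ?thesis .
  qed
  have col: "(\<Sum>p<d. \<Sum>q<d. X $$ (a * d + p, b * d + q) * cnj (X $$ (a * d + p, b * d + q))) =
      4 * (n * n * of_real (t\<^sup>2)) * (\<Sum>x\<in>?D. z a b x * cnj (z a b x))"
    if ab: "a < d" "b < d" for a b
  proof -
    have "(\<Sum>p<d. \<Sum>q<d. X $$ (a * d + p, b * d + q) * cnj (X $$ (a * d + p, b * d + q))) =
        (\<Sum>x\<in>?D. (\<Sum>j\<in>?I. (n * of_real t * w a b j) * gell_mann d j $$ x) *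
          cnj (\<Sum>j\<in>?I. (n * of_real t * w a b j) * gell_mann d j $$ x))"
      unfolding sum.cartesian_product' by (intro sum.cong refl) (simp only: entry ab lessThan_iff)
    also have "\<dots> = 2 * (\<Sum>j\<in>?I. (n * of_real t * w a b j) * cnj (n * of_real t * w a b j))"
      by (rule sum_mult_cnj_orthogonal)
        (simp_all only: sum.cartesian_product' gell_mann_orthogonal finite_atLeastAtMost)
    also have "\<dots> = 2 * (n * n * of_real (t\<^sup>2)) * (\<Sum>j\<in>?I. w a b j * cnj (w a b j))"
    proof -
      have "cnj n = n" by (simp add: n_def)
      then show ?thesis
        by (simp only: complex_cnj_mult complex_cnj_complex_of_real sum_distrib_left
            power2_eq_square of_real_mult mult_ac)
    qed
    also have "(\<Sum>j\<in>?I. w a b j * cnj (w a b j)) = 1 * (\<Sum>i\<in>?I. y a b i * cnj (y a b i))"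
      unfolding w_def
    proof (rule sum_mult_cnj_orthogonal)
      fix i k assume ik: "i \<in> ?I" "k \<in> ?I"
      then have lt: "i - 1 < d\<^sup>2 - 1" "k - 1 < d\<^sup>2 - 1" and eq: "i - 1 = k - 1 \<longleftrightarrow> i = k"
        by auto
      have "(\<Sum>j\<in>?I. V $$ (i - 1, j - 1) * V $$ (k - 1, j - 1)) =
          (\<Sum>j<d\<^sup>2 - 1. V $$ (i - 1, j) * V $$ (k - 1, j))"
        by (rule sum.reindex_bij_witness[where i = Suc and j = "\<lambda>j. j - 1"]) auto
      also have "\<dots> = (V * transpose_mat V) $$ (i - 1, k - 1)"
        using Vc lt by (simp add: scalar_prod_def lessThan_atLeast0)
      also have "\<dots> = (if i = k then 1 else 0)"
        unfolding VV using lt eq by simp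
      finally have "complex_of_real (\<Sum>j\<in>?I. V $$ (i - 1, j - 1) * V $$ (k - 1, j - 1)) =
          (if i = k then 1 else 0)"
        by (cases "i = k") simp_all
      then show "(\<Sum>j\<in>?I. v i j * cnj (v k j)) = (if i = k then 1 else 0)"
        by (simp only: v_def complex_cnj_complex_of_real of_real_sum of_real_mult)
    qed simp
    also have "(\<Sum>i\<in>?I. y a b i * cnj (y a b i)) = 2 * (\<Sum>x\<in>?D. z a b x * cnj (z a b x))"
      unfolding y_def
      by (rule gell_mann_frame) (simp only: z_def defect_kernel_unital[OF P ab])
    finally show ?thesis
      by simp
  qed
  have "complex_of_real ((hs_norm X)\<^sup>2) = (\<Sum>r<d * d. \<Sum>s<d * d. X $$ (r, s) * cnj (X $$ (r, s)))"
    by (rule hs_norm_square) (auto simp: X_def map_first_def)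
  also have "\<dots> = (\<Sum>a<d. \<Sum>p<d. \<Sum>b<d. \<Sum>q<d.
      X $$ (a * d + p, b * d + q) * cnj (X $$ (a * d + p, b * d + q)))"
  proof -
    have "(\<Sum>s<d * d. X $$ (r, s) * cnj (X $$ (r, s))) =
        (\<Sum>b<d. \<Sum>q<d. X $$ (r, b * d + q) * cnj (X $$ (r, b * d + q)))" for r
      using sum_mult_square_index[of "\<lambda>b q. X $$ (r, b * d + q) * cnj (X $$ (r, b * d + q))" d d]
      by simp
    then show ?thesis
      using sum_mult_square_index[of "\<lambda>a p. \<Sum>b<d. \<Sum>q<d.
        X $$ (a * d + p, b * d + q) * cnj (X $$ (a * d + p, b * d + q))" d d]
      by simp
  qed
  also have "\<dots> = (\<Sum>a<d. \<Sum>b<d. \<Sum>p<d. \<Sum>q<d.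
      X $$ (a * d + p, b * d + q) * cnj (X $$ (a * d + p, b * d + q)))"
    by (intro sum.cong refl sum.swap)
  also have "\<dots> = (\<Sum>a<d. \<Sum>b<d. 4 * (n * n * of_real (t\<^sup>2)) * (\<Sum>x\<in>?D. z a b x * cnj (z a b x)))"
    by (intro sum.cong refl) (simp only: col lessThan_iff)
  also have "\<dots> = 4 * (n * n * of_real (t\<^sup>2)) * (of_nat d * of_nat d - of_nat d)"
    unfolding sum_distrib_left[symmetric] z_def defect_kernel_norm[OF P] ..
  also have "\<dots> = complex_of_real (4 * (1 / real (d\<^sup>2) * (1 / real (d\<^sup>2)) * t\<^sup>2) * (real d * real d - real d))"
    by (simp add: n_def)
  finally have "(hs_norm X)\<^sup>2 = 4 * (1 / real (d\<^sup>2) * (1 / real (d\<^sup>2)) * t\<^sup>2) * (real d * real d - real d)"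
    by (simp only: of_real_eq_iff)
  also have "\<dots> = 4 * t\<^sup>2 * (real d - 1) / real d ^ 3"
    using d by (simp add: field_simps power2_eq_square power3_eq_cube)
  finally show ?thesis
    unfolding X_def .
qed

section \<open>Existence of a measurement\<close>

text \<open>The measurement in the standard basis is a witness that the set of values in the
  definition of \<open>discord\<close> is nonempty, so that its \<open>LEAST\<close> is
  meaningful.\<close>

lemma projective_measurement_mat_unit:
  "projective_measurement d (\<lambda>k. mat_unit d k k)"
proof -
  have carr: "mat_unit d k k \<in> carrier_mat d d" for k
    by (simp add: mat_unit_def)
  have adj: "mat_adjoint (mat_unit d k k) = mat_unit d k k" for k
  proof (rule eq_matI)
    fix a b assume "a < dim_row (mat_unit d k k)" "b < dim_col (mat_unit d k k)"
    then have ab: "a < d" "b < d" by (simp_all add: mat_unit_def)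
    then show "mat_adjoint (mat_unit d k k) $$ (a, b) = mat_unit d k k $$ (a, b)"
      unfolding mat_adjoint_index[OF carr ab]
      by (cases "Suc a = k"; cases "Suc b = k"; simp add: mat_unit_def)
  qed (auto simp: mat_adjoint_def mat_unit_def)
  have mult: "mat_unit d k k * mat_unit d l l = (if k = l then mat_unit d k k else 0\<^sub>m d d)" for k l
  proof (rule eq_matI)
    fix a b
    assume "a < dim_row (if k = l then mat_unit d k k else 0\<^sub>m d d)"
      and "b < dim_col (if k = l then mat_unit d k k else 0\<^sub>m d d)"
    then have ab: "a < d" "b < d" by (cases "k = l"; simp add: mat_unit_def)+
    have "(mat_unit d k k * mat_unit d l l) $$ (a, b) =
        (\<Sum>c<d. mat_unit d k k $$ (a, c) * mat_unit d l l $$ (c, b))"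
      using ab carr[of k] carr[of l] by (simp add: scalar_prod_def lessThan_atLeast0)
    also have "\<dots> = (\<Sum>c<d. if c = a then (if Suc a = k \<and> Suc a = l \<and> Suc b = l then 1 else 0) else 0)"
    proof (intro sum.cong refl)
      fix c assume "c \<in> {..<d}"
      then show "mat_unit d k k $$ (a, c) * mat_unit d l l $$ (c, b) =
          (if c = a then (if Suc a = k \<and> Suc a = l \<and> Suc b = l then 1 else 0) else 0)"
        using ab by (cases "c = a"; cases "Suc a = k"; cases "Suc c = k"; cases "Suc c = l"; cases "Suc b = l";
            simp add: mat_unit_def)
    qed
    also have "\<dots> = (if Suc a = k \<and> Suc a = l \<and> Suc b = l then 1 else 0)"
      using ab by (simp only: sum.delta finite_lessThan lessThan_iff if_True)
    also have "\<dots> = (if k = l then mat_unit d k k else 0\<^sub>m d d) $$ (a, b)"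
      using ab by (cases "k = l"; cases "Suc a = k"; cases "Suc b = l"; simp add: mat_unit_def)
    finally show "(mat_unit d k k * mat_unit d l l) $$ (a, b) =
        (if k = l then mat_unit d k k else 0\<^sub>m d d) $$ (a, b)" .
  qed (simp_all add: mat_unit_def)
  \<comment> \<open>The rank is at most one because the entries factor into a row and a column
    function, and at least one because of the nonzero minor at position
    \<open>(k - 1, k - 1)\<close>.\<close>
  have rank: "vec_space.rank d (mat_unit d k k) = 1" if k: "k \<in> {1..d}" for k
  proof (rule antisym)
    show "vec_space.rank d (mat_unit d k k) \<le> 1"
    proof (rule vec_space.rank_le_1_product_entries[OF carr])
      fix r c assume "r < dim_row (mat_unit d k k)" "c < dim_col (mat_unit d k k)"
      then show "mat_unit d k k $$ (r, c) =
          (if Suc r = k then 1 else 0) * (if Suc c = k then 1 else 0)"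
        by (cases "Suc r = k"; cases "Suc c = k"; simp add: mat_unit_def)
    qed
    let ?S = "submatrix (mat_unit d k k) {k - 1} {k - 1}"
    have I: "{i. i < d \<and> i \<in> {k - 1}} = {k - 1}" using k by auto
    have card: "card {i. i < d \<and> i \<in> {k - 1}} = 1" unfolding I by simp
    \<comment> \<open>Entry 0 of the submatrix is reached through the least element of the index set
      \<open>{k - 1}\<close>.\<close>
    have pick: "(LEAST a. a = k - Suc 0) = k - Suc 0" by (rule Least_equality) simp_all
    have S: "?S \<in> carrier_mat 1 1"
      using card carr[of k] by (auto simp: submatrix_def)
    have "?S $$ (0, 0) = mat_unit d k k $$ (k - 1, k - 1)"
      using card carr[of k] by (subst submatrix_index) (simp_all add: pick)
    also have "\<dots> = 1"
    proof -
      have "k - 1 < d" "Suc (k - 1) = k" using k by auto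
      then show ?thesis by (simp add: mat_unit_def)
    qed
    finally have "det ?S \<noteq> 0" using S by (simp add: det_single)
    then have "card {j. j < d \<and> j \<in> {k - 1}} \<le> vec_space.rank d (mat_unit d k k)"
      by (rule vec_space.rank_gt_minor[OF carr])
    then show "1 \<le> vec_space.rank d (mat_unit d k k)" unfolding card .
  qed
  have total: "mat_sum d {1..d} (\<lambda>k. mat_unit d k k) = 1\<^sub>m d"
  proof (rule eq_matI)
    fix a b assume "a < dim_row (1\<^sub>m d)" "b < dim_col (1\<^sub>m d)"
    then have ab: "a < d" "b < d" by simp_all
    then have "mat_sum d {1..d} (\<lambda>k. mat_unit d k k) $$ (a, b) =
        (\<Sum>k = 1..d. mat_unit d k k $$ (a, b))"
      by (simp add: mat_sum_def)
    also have "\<dots> = (\<Sum>k = 1..d. if k = Suc a then (if a = b then 1 else 0) else 0)"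
    proof (intro sum.cong refl)
      fix k
      show "mat_unit d k k $$ (a, b) = (if k = Suc a then (if a = b then 1 else 0) else 0)"
        using ab by (cases "k = Suc a"; cases "a = b"; simp add: mat_unit_def)
    qed
    also have "\<dots> = 1\<^sub>m d $$ (a, b)"
      using ab by simp
    finally show "mat_sum d {1..d} (\<lambda>k. mat_unit d k k) $$ (a, b) = 1\<^sub>m d $$ (a, b)" .
  qed (simp_all add: mat_sum_def)
  show ?thesis
    unfolding projective_measurement_def using carr adj mult rank total by simp
qed

section \<open>Eigenvalues entering the lower bound\<close>

lemma eigvals_desc_smult_one:
  "eigvals_desc (c \<cdot>\<^sub>m 1\<^sub>m n) = replicate n c"
proof -
  have ut: "upper_triangular (c \<cdot>\<^sub>m 1\<^sub>m n)" by auto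
  have "diag_mat (c \<cdot>\<^sub>m 1\<^sub>m n) = replicate n c"
    by (intro nth_equalityI) (auto simp: diag_mat_def)
  then have "char_poly (c \<cdot>\<^sub>m 1\<^sub>m n) = [:- c, 1:] ^ n"
    by (simp add: char_poly_upper_triangular[OF smult_carrier_mat[OF one_carrier_mat] ut])
  then have "proots (char_poly (c \<cdot>\<^sub>m 1\<^sub>m n)) = mset (replicate n c)"
    by (simp add: proots_power repeat_mset_replicate_mset)
  then show ?thesis
    by (simp add: eigvals_desc_def sorted_sort_id sorted_list_of_multiset_mset del: mset_replicate)
qed

text \<open>Orthogonality makes the correlation matrix times its transpose equal to
  \<open>t\<^sup>2\<close> times the identity, so all eigenvalues coincide, and the range from
  \<open>d\<close> to \<open>d\<^sup>2 - 1\<close> has \<open>d\<^sup>2 - d\<close> terms.\<close>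

lemma Xi_smult_orthogonal:
  assumes V: "V \<in> orthogonal_group (d\<^sup>2 - 1)" and d: "d > 0"
  shows "Xi d (t \<cdot>\<^sub>m V) = t\<^sup>2 * (real d * (real d - 1))"
proof -
  have Vc: "V \<in> carrier_mat (d\<^sup>2 - 1) (d\<^sup>2 - 1)" and VV: "V * transpose_mat V = 1\<^sub>m (d\<^sup>2 - 1)"
    using V by (auto simp: orthogonal_group_def)
  have "(t \<cdot>\<^sub>m V) * transpose_mat (t \<cdot>\<^sub>m V) = t\<^sup>2 \<cdot>\<^sub>m (V * transpose_mat V)"
    using Vc by (intro eq_matI)
      (auto simp: scalar_prod_def sum_distrib_left power2_eq_square mult_ac)
  then have "Xi d (t \<cdot>\<^sub>m V) = (\<Sum>j = d..d\<^sup>2 - 1. replicate (d\<^sup>2 - 1) (t\<^sup>2) ! (j - 1))"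
    by (simp only: Xi_def VV eigvals_desc_smult_one)
  also have "\<dots> = (\<Sum>j = d..d\<^sup>2 - 1. t\<^sup>2)"
    using d by (intro sum.cong refl nth_replicate) auto
  also have "\<dots> = real (d\<^sup>2 - d) * t\<^sup>2"
    using d by (cases "d\<^sup>2") (auto simp: Suc_diff_le)
  also have "\<dots> = t\<^sup>2 * (real d * (real d - 1))"
    using d by (simp add: of_nat_diff power2_eq_square algebra_simps)
  finally show ?thesis .
qed

section \<open>Value of the discord and equality in the lower bound\<close>

theorem theorem2:
  fixes d :: nat and t :: real and V0 :: "real mat"
  assumes "d \<ge> 3"
    and "V0 \<in> orthogonal_group (d\<^sup>2 - 1)"
    and "t \<cdot>\<^sub>m V0 \<in> corr_matrices d"
  shows "discord d (lmm_state d (t \<cdot>\<^sub>m V0)) = 4 * t\<^sup>2 / (real d)\<^sup>2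
    \<and> discord d (lmm_state d (t \<cdot>\<^sub>m V0)) =
        4 / ((real d) ^ 3 * (real d - 1)) * Xi d (t \<cdot>\<^sub>m V0)"
proof -
  let ?\<rho> = "lmm_state d (t \<cdot>\<^sub>m V0)"
  have d: "d > 0" "real d \<noteq> 0" "real d - 1 \<noteq> 0" using assms(1) by auto
  \<comment> \<open>The set of squared distances is a singleton: one inclusion expresses
    independence of the measurement, the other its existence. Its \<open>LEAST\<close> is then the
    single value.\<close>
  have "{(hs_norm (?\<rho> - map_first d (measure_map d P) ?\<rho>))\<^sup>2 | P. projective_measurement d P} =
      {4 * t\<^sup>2 * (real d - 1) / real d ^ 3}"
    (is "?S = {?v}")
  proof (intro equalityI subsetI)
    fix x assume "x \<in> ?S"
    then obtain P where "projective_measurement d P"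
      and "x = (hs_norm (?\<rho> - map_first d (measure_map d P) ?\<rho>))\<^sup>2"
      unfolding mem_Collect_eq by (elim exE conjE)
    then show "x \<in> {?v}"
      by (simp only: measurement_defect_norm[OF _ d(1) assms(2)] singleton_iff)
  next
    fix x assume "x \<in> {?v}"
    then have "x = (hs_norm (?\<rho> - map_first d (measure_map d (\<lambda>k. mat_unit d k k)) ?\<rho>))\<^sup>2"
      by (simp only: measurement_defect_norm[OF projective_measurement_mat_unit d(1) assms(2)]
          singleton_iff)
    then show "x \<in> ?S"
      unfolding mem_Collect_eq using projective_measurement_mat_unit by (intro exI conjI)
  qed
  then have "discord d ?\<rho> = real d / (real d - 1) * (4 * t\<^sup>2 * (real d - 1) / real d ^ 3)"
    unfolding discord_def by (simp add: Least_equality)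
  also have "\<dots> = 4 * t\<^sup>2 / (real d)\<^sup>2"
    using d by (simp add: field_simps power2_eq_square power3_eq_cube)
  finally have "discord d ?\<rho> = 4 * t\<^sup>2 / (real d)\<^sup>2" .
  moreover have "4 / ((real d) ^ 3 * (real d - 1)) * Xi d (t \<cdot>\<^sub>m V0) = 4 * t\<^sup>2 / (real d)\<^sup>2"
    unfolding Xi_smult_orthogonal[OF assms(2) d(1)] using d
    by (simp add: power2_eq_square power3_eq_cube)
  ultimately show ?thesis by simp
qed

end
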